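(* Let $d\ge1$ and let $A\in\mathcal{B}(\mathbb{Z}^d,\mathbb{Z}^d)$. If $A$ has $\ell^q_w$-stability for some $1\le q<\infty$ and for some discrete $A_q$-weight $w$, then $A$ has $\ell^{q'}_{w'}$-stability for all $1\le q'<\infty$ and for all discrete $A_{q'}$-weights $w'$. (Here $q'$ is an arbitrary exponent, not the conjugate exponent of $q$.)
   Context: For $x=(x_1,\dots,x_d)\in\mathbb{R}^d$ put $|x|_\infty=\max(|x_1|,\dots,|x_d|)$. $\mathcal{B}(\mathbb{Z}^d,\mathbb{Z}^d)$ is the set of all complex infinite matrices $A=(a(i,j))_{i,j\in\mathbb{Z}^d}$ with $$\|A\|_{\mathcal{B}}:=\sum_{k\in\mathbb{Z}^d}\Big(\sup_{|i-j|_\infty\ge|k|_\infty}|a(i,j)|\Big)<\infty .$$ A positive sequence $w=(w(i))_{i\in\mathbb{Z}^d}$ is a discrete $A_q$-weight, for $1<q<\infty$, if there is a constant $C$ with $$\Big(N^{-d}\sum_{i\in a+[0,N-1]^d}w(i)\Big)\Big(N^{-d}\sum_{i\in a+[0,N-1]^d}w(i)^{-1/(q-1)}\Big)^{q-1}\le C$$ for all $a\in\mathbb{Z}^d$ and all integers $N\ge1$; it is a discrete $A_1$-weight if there is a constant $C$ with $N^{-d}\sum_{i\in a+[0,N-1]^d}w(i)\le C\inf_{i\in a+[0,N-1]^d}w(i)$ for all such $a,N$ (sums and infima over integer points). $\ell^q_w$ is the space of sequences $c=(c(i))_{i\in\mathbb{Z}^d}$ with $\|c\|_{q,w}:=(\sum_i|c(i)|^qw(i))^{1/q}<\infty$.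 A matrix $A$ acts by $(Ac)(i)=\sum_{j}a(i,j)c(j)$. $A$ has $\ell^q_w$-stability if there is a positive constant $C$ such that $C^{-1}\|c\|_{q,w}\le\|Ac\|_{q,w}\le C\|c\|_{q,w}$ for all $c\in\ell^q_w$. *)

theory Defs
  imports "HOL-Analysis.Analysis"
begin

text \<open>
  The lattice \<open>\<int>\<^sup>d\<close> is the type \<^typ>\<open>int ^ 'd\<close>, with \<open>d = CARD('d) \<ge> 1\<close>.
\<close>

type_synonym 'd lattice_matrix = "int ^ 'd \<Rightarrow> int ^ 'd \<Rightarrow> complex"

definition maxnorm :: "int ^ 'd::finite \<Rightarrow> int" where
  "maxnorm x = Max (range (\<lambda>n. \<bar>x $ n\<bar>))"

text \<open>
  The norm takes values in \<^typ>\<open>ennreal\<close>, so neither the suprema nor the sum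
  need a boundedness or summability side condition.
\<close>

definition B_norm :: "'d::finite lattice_matrix \<Rightarrow> ennreal" where
  "B_norm A =
     (\<Sum>\<^sub>\<infinity>k::int ^ 'd. SUP (i, j) \<in> {(i, j). maxnorm (i - j) \<ge> maxnorm k}. ennreal (cmod (A i j)))"

definition B_class :: "'d::finite lattice_matrix set" where
  "B_class = {A. B_norm A < \<infinity>}"

definition cube :: "int ^ 'd \<Rightarrow> nat \<Rightarrow> (int ^ 'd) set" where
  "cube a N = {i. \<forall>n. a $ n \<le> i $ n \<and> i $ n \<le> a $ n + (int N - 1)}"

definition cube_avg :: "int ^ 'd \<Rightarrow> nat \<Rightarrow> (int ^ 'd \<Rightarrow> real) \<Rightarrow> real" where
  "cube_avg a N f = (\<Sum>i\<in>cube a N. f i) / real N ^ CARD('d)"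

text \<open>Meaningful for \<open>q \<ge> 1\<close> only.\<close>

definition discrete_A_weight :: "real \<Rightarrow> (int ^ 'd \<Rightarrow> real) \<Rightarrow> bool" where
  "discrete_A_weight q w \<longleftrightarrow>
     (\<forall>i. w i > 0) \<and>
     (if q = 1
      then \<exists>C. \<forall>a N. N \<ge> 1 \<longrightarrow> cube_avg a N w \<le> C * (INF i\<in>cube a N. w i)
      else \<exists>C. \<forall>a N. N \<ge> 1 \<longrightarrow>
             cube_avg a N w * cube_avg a N (\<lambda>i. w i powr (- 1 / (q - 1))) powr (q - 1) \<le> C)"

definition weighted_lq :: "real \<Rightarrow> (int ^ 'd \<Rightarrow> real) \<Rightarrow> (int ^ 'd \<Rightarrow> complex) set" where
  "weighted_lq q w = {c. (\<lambda>i. cmod (c i) powr q * w i) summable_on UNIV}"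

definition lq_norm :: "real \<Rightarrow> (int ^ 'd \<Rightarrow> real) \<Rightarrow> (int ^ 'd \<Rightarrow> complex) \<Rightarrow> real" where
  "lq_norm q w c = (\<Sum>\<^sub>\<infinity>i. cmod (c i) powr q * w i) powr (1 / q)"

definition mat_apply :: "'d::finite lattice_matrix \<Rightarrow> (int ^ 'd \<Rightarrow> complex) \<Rightarrow> int ^ 'd \<Rightarrow> complex" where
  "mat_apply A c i = (\<Sum>\<^sub>\<infinity>j. A i j * c j)"

text \<open>
  As \<^const>\<open>infsum\<close> is 0 on non-summable families, stability states explicitly that the
  series defining \<open>A c\<close> converge and that \<open>A c\<close> has finite norm.
\<close>

definition lq_stable :: "real \<Rightarrow> (int ^ 'd \<Rightarrow> real) \<Rightarrow> 'd::finite lattice_matrix \<Rightarrow> bool" where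
  "lq_stable q w A \<longleftrightarrow>
     (\<exists>C>0. \<forall>c\<in>weighted_lq q w.
        (\<forall>i. (\<lambda>j. A i j * c j) summable_on UNIV) \<and>
        mat_apply A c \<in> weighted_lq q w \<and>
        inverse C * lq_norm q w c \<le> lq_norm q w (mat_apply A c) \<and>
        lq_norm q w (mat_apply A c) \<le> C * lq_norm q w c)"

end

theory Submission
  imports Defs
begin

text \<open>
  The only consequence of the weight condition that is needed is
  \<open>(avg\<^sub>Q f)\<^sup>q w(Q) \<le> K \<Sum>\<^sub>Q f\<^sup>q w\<close> for all cubes \<open>Q\<close> and all \<open>f \<ge> 0\<close>. It makes averaging over
  cubes bounded on the weighted space, uniformly in the size of the cube, and a matrix in the
  Beurling class is dominated by an absolutely convergent combination of averages at dyadic scales.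

  Stability is first localized: apply it in the source space to \<open>\<psi> c\<close> for a cutoff \<open>\<psi>\<close> at scale
  \<open>N = 2\<^sup>M\<close> about a point \<open>n\<close>. The commutator of \<open>A\<close> with \<open>\<psi>\<close> gains a factor \<open>min 1 (\<bar>i - j\<bar> / N)\<close>,
  so its total size tends to 0 with \<open>N\<close>. In terms of the local means
  \<open>m(n) = (\<Sum>\<^sub>Q \<bar>c\<bar>\<^sup>q w / w(Q))\<^bsup>1/q\<^esup>\<close> over the cube \<open>Q\<close> of radius \<open>N\<close> about \<open>n\<close>, this reads
  \<open>m \<le> C\<^sub>N avg \<bar>Ac\<bar> + T\<^sub>N m\<close> pointwise, where \<open>T\<^sub>N\<close> is a combination of averages with
  small total mass. The source weight and exponent enter only through \<open>m\<close>,
  so one can take the norm of the target space, choose \<open>N\<close> depending on the target weight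
  and absorb \<open>T\<^sub>N m\<close>.
\<close>

subsection \<open>Cubes and weights\<close>

lemma convex_powr_nonneg:
  fixes q :: real
  assumes "1 \<le> q"
  shows "convex_on {0..} (\<lambda>x. x powr q)"
proof (rule convex_onI)
  fix t x y :: real
  assume t: "0 < t" "t < 1" and xy: "x \<in> {0..}" "y \<in> {0..}"
  have scale: "(s * z) powr q \<le> s * z powr q" if "0 < s" "s < 1" "0 \<le> z" for s z :: real
  proof -
    have "s powr q \<le> s"
      using powr_mono'[of 1 q s] assms that by simp
    then show ?thesis using that by (simp add: powr_mult mult_right_mono)
  qed
  show "((1 - t) *\<^sub>R x + t *\<^sub>R y) powr q \<le> (1 - t) * x powr q + t * y powr q"
  proof (cases "x = 0 \<or> y = 0")
    case True
    then show ?thesis using scale[of t y] scale[of "1 - t" x] t xy by auto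
  next
    case False
    then show ?thesis using convex_onD[OF powr_convex[OF assms], of t x y] t xy by auto
  qed
qed simp

text \<open>Jensen's inequality for masses of arbitrary total: normalizing by \<open>sum e S\<close>
  produces the factor with exponent \<open>q - 1\<close>. It does the work of Hoelder's inequality
  in the weight condition and of Minkowski's inequality for series of averages.\<close>

lemma jensen_powr:
  fixes e x :: "'a \<Rightarrow> real"
  assumes "finite S" "\<And>i. i \<in> S \<Longrightarrow> 0 \<le> e i" "\<And>i. i \<in> S \<Longrightarrow> 0 \<le> x i" "1 \<le> q"
  shows "(\<Sum>i\<in>S. e i * x i) powr q \<le> sum e S powr (q - 1) * (\<Sum>i\<in>S. e i * x i powr q)"
proof (cases "sum e S = 0")
  case True
  then have "e i = 0" if "i \<in> S" for i
    using assms that by (simp add: sum_nonneg_eq_0_iff)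
  then show ?thesis by simp
next
  case False
  define E where "E = sum e S"
  have E: "E > 0" using False assms(2) unfolding E_def by (metis order_le_less sum_nonneg)
  have ne: "S \<noteq> {}" using False by auto
  have "(\<Sum>i\<in>S. (e i / E) *\<^sub>R x i) powr q \<le> (\<Sum>i\<in>S. e i / E * x i powr q)"
  proof (rule convex_on_sum[OF assms(1) ne convex_powr_nonneg[OF assms(4)]])
    show "(\<Sum>i\<in>S. e i / E) = 1" using E by (simp add: E_def flip: sum_divide_distrib)
  qed (use assms E in auto)
  then have *: "((\<Sum>i\<in>S. e i * x i) / E) powr q \<le> (\<Sum>i\<in>S. e i * x i powr q) / E"
    by (simp add: sum_divide_distrib)
  have nn: "0 \<le> (\<Sum>i\<in>S. e i * x i)" using assms by (intro sum_nonneg) auto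
  have "(\<Sum>i\<in>S. e i * x i) powr q = E powr q * ((\<Sum>i\<in>S. e i * x i) / E) powr q"
    using E nn by (simp add: powr_divide)
  also have "\<dots> \<le> E powr q * ((\<Sum>i\<in>S. e i * x i powr q) / E)"
    by (rule mult_left_mono[OF *]) simp
  also have "\<dots> = E powr (q - 1) * (\<Sum>i\<in>S. e i * x i powr q)"
    using E by (simp add: powr_diff)
  finally show ?thesis by (simp add: E_def)
qed

section \<open>Balls of the maximum norm and averages over them\<close>

definition qbox :: "nat \<Rightarrow> int ^ 'd::finite \<Rightarrow> (int ^ 'd) set" where
  "qbox r x = {j. maxnorm (j - x) \<le> int r}"

lemma maxnorm_le_iff: "maxnorm x \<le> m \<longleftrightarrow> (\<forall>n. \<bar>x $ n\<bar> \<le> m)"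
  unfolding maxnorm_def by (subst Max_le_iff) auto

lemma maxnorm_nonneg: "0 \<le> maxnorm x"
  by (meson abs_ge_zero maxnorm_le_iff order_refl order_trans)

lemma maxnorm_triangle: "maxnorm (x + y) \<le> maxnorm x + maxnorm y"
  unfolding maxnorm_le_iff[of "x + y"]
proof
  fix n
  have "\<bar>x $ n\<bar> \<le> maxnorm x" "\<bar>y $ n\<bar> \<le> maxnorm y" by (meson maxnorm_le_iff order_refl)+
  then show "\<bar>(x + y) $ n\<bar> \<le> maxnorm x + maxnorm y" by simp
qed

lemma maxnorm_minus: "maxnorm (- x) = maxnorm x"
  by (simp add: maxnorm_def)

lemma maxnorm_diff_commute: "maxnorm (x - y) = maxnorm (y - x)"
  using maxnorm_minus[of "x - y"] by simp

lemma maxnorm_diff_triangle: "maxnorm (x - z) \<le> maxnorm (x - y) + maxnorm (y - z)"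
  using maxnorm_triangle[of "x - y" "y - z"] by simp

lemma qbox_commute: "j \<in> qbox r x \<longleftrightarrow> x \<in> qbox r j"
  by (simp add: qbox_def maxnorm_diff_commute)

lemma qbox_trans: "x \<in> qbox r y \<Longrightarrow> y \<in> qbox s z \<Longrightarrow> r + s \<le> t \<Longrightarrow> x \<in> qbox t z"
  using maxnorm_diff_triangle[of x z y] by (simp add: qbox_def)

lemma qbox_mono: "r \<le> s \<Longrightarrow> qbox r x \<subseteq> qbox s x"
  by (auto simp: qbox_def)

lemma self_in_qbox [simp]: "x \<in> qbox r x"
  by (simp add: qbox_def maxnorm_le_iff)

lemma finite_cube [simp]: "finite (cube (a :: int ^ 'd::finite) N)"
  and card_cube: "card (cube (a :: int ^ 'd::finite) N) = N ^ CARD('d)"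
proof -
  let ?P = "Pi\<^sub>E (UNIV :: 'd set) (\<lambda>n. {a $ n..a $ n + (int N - 1)})"
  have eq: "cube a N = vec_lambda ` ?P"
  proof (intro equalityI subsetI)
    fix i assume "i \<in> cube a N"
    then have "vec_nth i \<in> ?P" by (auto simp: cube_def)
    then show "i \<in> vec_lambda ` ?P" by (metis image_eqI vec_nth_inverse)
  qed (auto simp: cube_def PiE_def Pi_def)
  have fin: "finite ?P" by (intro finite_PiE) auto
  then show "finite (cube a N)" by (simp add: eq)
  have "inj_on vec_lambda ?P" by (auto simp: inj_on_def vec_lambda_inject)
  then have "card (cube a N) = card ?P" by (simp add: eq card_image)
  also have "\<dots> = N ^ CARD('d)" by (simp add: card_PiE)
  finally show "card (cube a N) = N ^ CARD('d)" .
qed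

lemma qbox_eq_cube: "qbox r x = cube (\<chi> n. x $ n - int r) (2 * r + 1)"
  unfolding qbox_def cube_def maxnorm_le_iff
  by (rule Collect_cong, rule all_cong1) (simp add: abs_le_iff, arith)

lemma finite_qbox [simp]: "finite (qbox r x)"
  by (simp add: qbox_eq_cube)

definition side :: "nat \<Rightarrow> real" where
  "side r = real (2 * r + 1)"

lemma side_pos [simp]: "0 < side r" and side_nonneg [simp]: "0 \<le> side r"
  and side_neq_0 [simp]: "side r \<noteq> 0"
  by (simp_all add: side_def)

lemma side_mult_le: "1 \<le> m \<Longrightarrow> side (m * r) \<le> real m * side r"
  by (simp add: side_def algebra_simps)

lemma card_qbox: "real (card (qbox r (x :: int ^ 'd::finite))) = side r ^ CARD('d)"
  by (simp add: qbox_eq_cube card_cube side_def)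

definition avg :: "nat \<Rightarrow> (int ^ 'd::finite \<Rightarrow> real) \<Rightarrow> int ^ 'd \<Rightarrow> real" where
  "avg r f x = sum f (qbox r x) / side r ^ CARD('d)"

lemma sum_qbox_eq_avg: "sum f (qbox r x) = side r ^ CARD('d) * avg r f x"
  for f :: "int ^ 'd::finite \<Rightarrow> real"
  by (simp add: avg_def)

lemma avg_nonneg: "(\<And>i. 0 \<le> f i) \<Longrightarrow> 0 \<le> avg r f x"
  by (simp add: avg_def sum_nonneg)

text \<open>One inequality covers q = 1 and q > 1, so no later argument distinguishes the two cases.
  The constant is a parameter, which lets later constants be written down explicitly.\<close>

locale aq_weight =
  fixes q :: real and w :: "int ^ 'd::finite \<Rightarrow> real" and K :: real
  assumes q_ge_1: "1 \<le> q" and w_pos: "0 < w i" and K_pos: "0 < K"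
    and avg_powr_le: "(\<And>i. 0 \<le> f i) \<Longrightarrow>
          avg r f x powr q * sum w (qbox r x) \<le> K * (\<Sum>i\<in>qbox r x. f i powr q * w i)"

text \<open>For q = 1, w is bounded below by its infimum over the cube. For q > 1 this is Hoelder's
  inequality, obtained from \<open>jensen_powr\<close> with masses v = w^(-1/(q-1)) and values f/v,
  because v (f/v)^q = f^q w. Taking \<open>max C 1\<close> makes the constant positive.\<close>

lemma discrete_A_weight_imp_aq_weight:
  fixes w :: "int ^ 'd::finite \<Rightarrow> real"
  assumes "1 \<le> q" "discrete_A_weight q w"
  obtains K where "aq_weight q w K"
proof (cases "q = 1")
  case True
  then obtain C where pos: "\<And>i. 0 < w i"
    and C: "\<And>a N. 1 \<le> N \<Longrightarrow> cube_avg a N w \<le> C * (INF i\<in>cube a N. w i)"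
    using assms(2) unfolding discrete_A_weight_def by auto
  have "aq_weight q w (max C 1)"
  proof
    fix f :: "int ^ 'd \<Rightarrow> real" and r and x :: "int ^ 'd"
    assume f: "\<And>i. 0 \<le> f i"
    define m where "m = (INF i\<in>qbox r x. w i)"
    have m_le: "m \<le> w i" if "i \<in> qbox r x" for i
      unfolding m_def by (rule cINF_lower[OF _ that]) (simp add: bdd_below_finite)
    have m0: "0 \<le> m" unfolding m_def
      using pos by (intro cINF_greatest) (auto intro: less_imp_le self_in_qbox)
    have "avg r w x \<le> C * m"
      using C[of "2 * r + 1" "\<chi> n. x $ n - int r"]
      by (simp add: cube_avg_def avg_def m_def qbox_eq_cube side_def)
    also have "\<dots> \<le> max C 1 * m" using m0 by (intro mult_right_mono) auto
    finally have w: "avg r w x \<le> max C 1 * m" .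
    have "avg r f x powr q * sum w (qbox r x) = sum f (qbox r x) * avg r w x"
      using True f by (simp add: avg_def sum_nonneg)
    also have "\<dots> \<le> sum f (qbox r x) * (max C 1 * m)"
      using f by (intro mult_left_mono w sum_nonneg) auto
    also have "\<dots> = max C 1 * (\<Sum>i\<in>qbox r x. f i * m)"
      by (simp add: sum_distrib_right sum_distrib_left mult_ac)
    also have "\<dots> \<le> max C 1 * (\<Sum>i\<in>qbox r x. f i * w i)"
      using f m_le by (intro mult_left_mono sum_mono) auto
    finally show "avg r f x powr q * sum w (qbox r x) \<le> max C 1 * (\<Sum>i\<in>qbox r x. f i powr q * w i)"
      using True f by simp
  qed (use assms pos in auto)
  then show ?thesis by (rule that)
next
  case False
  then have q: "1 < q" using assms by simp
  obtain C where pos: "\<And>i. 0 < w i"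
    and C: "\<And>a N. 1 \<le> N \<Longrightarrow>
      cube_avg a N w * cube_avg a N (\<lambda>i. w i powr (- 1 / (q - 1))) powr (q - 1) \<le> C"
    using assms(2) False unfolding discrete_A_weight_def by auto
  define v where "v i = w i powr (- 1 / (q - 1))" for i
  have "aq_weight q w (max C 1)"
  proof
    fix f :: "int ^ 'd \<Rightarrow> real" and r and x :: "int ^ 'd"
    assume f: "\<And>i. 0 \<le> f i"
    let ?V = "side r ^ CARD('d)"
    let ?Q = "qbox r x"
    have v: "0 < v i" for i using pos[of i] by (simp add: v_def)
    have vq: "v i powr (1 - q) = w i" for i
    proof -
      have "- 1 / (q - 1) * (1 - q) = 1" using q by (simp add: field_simps)
      then show ?thesis using pos[of i] unfolding v_def powr_powr by simp
    qed
    have "sum f ?Q powr q = (\<Sum>i\<in>?Q. v i * (f i / v i)) powr q"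
      using v by (simp add: less_imp_neq[symmetric])
    also have "\<dots> \<le> sum v ?Q powr (q - 1) * (\<Sum>i\<in>?Q. v i * (f i / v i) powr q)"
      by (rule jensen_powr) (use f v assms in \<open>auto intro: less_imp_le divide_nonneg_pos\<close>)
    also have "(\<Sum>i\<in>?Q. v i * (f i / v i) powr q) = (\<Sum>i\<in>?Q. f i powr q * w i)"
    proof (rule sum.cong)
      fix i
      have "v i * (f i / v i) powr q = f i powr q * (v i / v i powr q)"
        using v[of i] f[of i] by (simp add: powr_divide)
      also have "v i / v i powr q = v i powr (1 - q)"
        using v[of i] by (simp add: powr_diff)
      finally show "v i * (f i / v i) powr q = f i powr q * w i" by (simp only: vq)
    qed simp
    finally have 1: "sum f ?Q powr q \<le> sum v ?Q powr (q - 1) * (\<Sum>i\<in>?Q. f i powr q * w i)" .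
    have 2: "avg r w x * avg r v x powr (q - 1) \<le> C"
      using C[of "2 * r + 1" "\<chi> n. x $ n - int r"]
      by (simp add: cube_avg_def avg_def qbox_eq_cube side_def v_def)
    have s0: "0 \<le> sum w ?Q" "0 \<le> sum v ?Q" "0 \<le> sum f ?Q"
      using pos v f by (auto intro!: sum_nonneg intro: less_imp_le)
    have "avg r f x powr q * sum w ?Q = sum f ?Q powr q * (sum w ?Q / ?V powr q)"
      using s0 by (simp add: avg_def powr_divide)
    also have "\<dots> \<le> (sum v ?Q powr (q - 1) * (\<Sum>i\<in>?Q. f i powr q * w i)) * (sum w ?Q / ?V powr q)"
      using s0 by (intro mult_right_mono 1) auto
    \<comment> \<open>The volume power splits as V^q = V * V^(q-1), which normalizes both averages
      of the weight condition.\<close>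
    also have "\<dots> = (avg r w x * avg r v x powr (q - 1)) * (\<Sum>i\<in>?Q. f i powr q * w i)"
      using s0 by (simp add: avg_def powr_divide powr_diff mult_ac)
    also have "\<dots> \<le> max C 1 * (\<Sum>i\<in>?Q. f i powr q * w i)"
      using 2 pos by (intro mult_right_mono sum_nonneg mult_nonneg_nonneg less_imp_le[OF pos]) auto
    finally show "avg r f x powr q * sum w ?Q \<le> max C 1 * (\<Sum>i\<in>?Q. f i powr q * w i)" .
  qed (use assms pos in auto)
  then show ?thesis by (rule that)
qed

subsection \<open>Averaging operators\<close>

lemma finite_sum_le_infsum_UNIV:
  fixes f :: "'a \<Rightarrow> real"
  assumes "f summable_on UNIV" "finite I" "\<And>i. 0 \<le> f i"
  shows "sum f I \<le> infsum f UNIV"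
  using assms by (intro finite_sum_le_infsum) auto

lemma summable_on_and_infsum_le:
  fixes f :: "'a \<Rightarrow> real"
  assumes "\<And>i. 0 \<le> f i" "\<And>I. finite I \<Longrightarrow> sum f I \<le> B"
  shows "f summable_on UNIV" "infsum f UNIV \<le> B"
proof -
  show "f summable_on UNIV"
    using assms by (intro nonneg_bdd_above_summable_on) (auto simp: bdd_above_def)
  then show "infsum f UNIV \<le> B" using assms by (intro infsum_le_finite_sums) auto
qed

section \<open>Averages, and series of averages, on one weighted space\<close>

context aq_weight
begin

text \<open>With c = 2^d, a factor c^q comes from comparing averages over radii r and 2r, and one
  more c from the overlap of the doubled balls. No radius enters.\<close>

definition avg_const :: real where
  "avg_const = 2 powr (real CARD('d) * (q + 1)) * K"

lemma avg_const_pos: "0 < avg_const"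
  using K_pos by (simp add: avg_const_def)

lemma w_nonneg [simp]: "0 \<le> w i"
  using w_pos by (rule less_imp_le)

lemma sum_w_pos [simp]: "0 < sum w (qbox r x)"
proof (rule sum_pos)
  show "qbox r x \<noteq> {}" using self_in_qbox by blast
qed (simp_all add: w_pos)

text \<open>
  The ball of radius \<open>r\<close> about \<open>i\<close> lies in the ball of radius \<open>2r\<close> about every \<open>x\<close> with
  \<open>\<bar>x - i\<bar> \<le> r\<close>; averaging over these \<open>x\<close> brings in the total weight of the \<open>r\<close>-ball
  about \<open>x\<close>, which the weight condition controls.
\<close>

lemma sum_avg_powr_le:
  assumes f: "\<And>i. 0 \<le> f i" and sm: "(\<lambda>i. f i powr q * w i) summable_on UNIV" and I: "finite I"
  shows "(\<Sum>i\<in>I. avg r f i powr q * w i) \<le> avg_const * (\<Sum>\<^sub>\<infinity>i. f i powr q * w i)"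
proof -
  let ?V = "\<lambda>r. side r ^ CARD('d)"
  let ?S = "\<Sum>\<^sub>\<infinity>i. f i powr q * w i"
  \<comment> \<open>A finite set containing every centre x that occurs, so that all interchanges
    below concern finite sums.\<close>
  define X where "X = (\<Union>i\<in>I. qbox r i)"
  define c :: real where "c = 2 ^ CARD('d)"
  have X: "finite X" using I by (simp add: X_def)
  have c: "c > 0" by (simp add: c_def)
  have V2: "?V (2 * r) \<le> c * ?V r"
    using power_mono[OF side_mult_le[of 2 r], of "CARD('d)"] by (simp add: c_def power_mult_distrib)
  have le1: "avg r f i \<le> c * avg (2 * r) f x" if "x \<in> qbox r i" for x i
  proof -
    have "sum f (qbox r i) \<le> sum f (qbox (2 * r) x)"
    proof (rule sum_mono2)
      show "qbox r i \<subseteq> qbox (2 * r) x"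
        using that qbox_commute[of x r i] by (auto intro: qbox_trans)
    qed (use f in auto)
    then have "avg r f i \<le> sum f (qbox (2 * r) x) / ?V r"
      by (simp add: avg_def divide_right_mono)
    also have "\<dots> = ?V (2 * r) / ?V r * avg (2 * r) f x" by (simp add: avg_def)
    also have "\<dots> \<le> c * avg (2 * r) f x"
      using V2 f by (intro mult_right_mono avg_nonneg) (simp_all add: divide_le_eq)
    finally show ?thesis .
  qed
  have le2: "?V r * (avg r f i powr q * w i) \<le> (\<Sum>x\<in>{x \<in> X. x \<in> qbox r i}. (c * avg (2 * r) f x) powr q * w i)"
    if "i \<in> I" for i
  proof -
    have eq: "{x \<in> X. x \<in> qbox r i} = qbox r i" using that by (auto simp: X_def)
    have "?V r * (avg r f i powr q * w i) = (\<Sum>x\<in>qbox r i. avg r f i powr q * w i)"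
      by (simp add: card_qbox)
    also have "\<dots> \<le> (\<Sum>x\<in>qbox r i. (c * avg (2 * r) f x) powr q * w i)"
      using le1 f q_ge_1 by (intro sum_mono mult_right_mono powr_mono2 avg_nonneg) auto
    finally show ?thesis by (simp add: eq)
  qed
  \<comment> \<open>Overlap count: j lies in the doubled balls of at most \<open>?V (2 * r)\<close>
    centres, since these centres are within 2r of j. The resulting \<open>?V r\<close> cancels at
    the end against the number of x used for each i.\<close>
  have "(\<Sum>x\<in>X. \<Sum>j\<in>{j \<in> (\<Union>x\<in>X. qbox (2 * r) x). j \<in> qbox (2 * r) x}. f j powr q * w j)
      = (\<Sum>j\<in>(\<Union>x\<in>X. qbox (2 * r) x). \<Sum>x\<in>{x \<in> X. j \<in> qbox (2 * r) x}. f j powr q * w j)"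
    using X by (intro sum.swap_restrict) auto
  also have "\<dots> \<le> (\<Sum>j\<in>(\<Union>x\<in>X. qbox (2 * r) x). ?V (2 * r) * (f j powr q * w j))"
  proof (rule sum_mono)
    fix j
    have "real (card {x \<in> X. j \<in> qbox (2 * r) x}) \<le> real (card (qbox (2 * r) j))"
      by (intro of_nat_mono card_mono) (auto simp: qbox_commute)
    then show "(\<Sum>x\<in>{x \<in> X. j \<in> qbox (2 * r) x}. f j powr q * w j) \<le> ?V (2 * r) * (f j powr q * w j)"
      by (simp add: card_qbox mult_right_mono)
  qed
  also have "\<dots> \<le> ?V (2 * r) * ?S"
    unfolding sum_distrib_left[symmetric]
    using X sm by (intro mult_left_mono finite_sum_le_infsum_UNIV) auto
  also have "\<dots> \<le> c * ?V r * ?S"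
    by (intro mult_right_mono V2 infsum_nonneg) auto
  finally have inner: "(\<Sum>x\<in>X. \<Sum>j\<in>{j \<in> (\<Union>x\<in>X. qbox (2 * r) x). j \<in> qbox (2 * r) x}. f j powr q * w j) \<le> c * ?V r * ?S" .
  have "?V r * (\<Sum>i\<in>I. avg r f i powr q * w i) \<le> (\<Sum>i\<in>I. \<Sum>x\<in>{x \<in> X. x \<in> qbox r i}. (c * avg (2 * r) f x) powr q * w i)"
    unfolding sum_distrib_left by (intro sum_mono le2)
  also have "\<dots> = (\<Sum>x\<in>X. \<Sum>i\<in>{i \<in> I. x \<in> qbox r i}. (c * avg (2 * r) f x) powr q * w i)"
    by (rule sum.swap_restrict[OF I X])
  also have "\<dots> \<le> (\<Sum>x\<in>X. (c * avg (2 * r) f x) powr q * sum w (qbox r x))"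
    unfolding sum_distrib_left[symmetric]
    by (intro sum_mono mult_left_mono sum_mono2) (auto simp: qbox_commute)
  \<comment> \<open>Summing w over radius 2r instead of r matches the radius of the average, as the
    weight condition requires.\<close>
  also have "\<dots> \<le> (\<Sum>x\<in>X. c powr q * (avg (2 * r) f x powr q * sum w (qbox (2 * r) x)))"
  proof (rule sum_mono)
    fix x
    have "(c * avg (2 * r) f x) powr q * sum w (qbox r x)
        = c powr q * (avg (2 * r) f x powr q * sum w (qbox r x))"
      using c f by (simp add: powr_mult avg_nonneg)
    also have "\<dots> \<le> c powr q * (avg (2 * r) f x powr q * sum w (qbox (2 * r) x))"
      by (intro mult_left_mono sum_mono2 qbox_mono) auto
    finally show "(c * avg (2 * r) f x) powr q * sum w (qbox r x) \<le> \<dots>" .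
  qed
  also have "\<dots> \<le> (\<Sum>x\<in>X. c powr q * (K * (\<Sum>j\<in>qbox (2 * r) x. f j powr q * w j)))"
    using f by (intro sum_mono mult_left_mono avg_powr_le) auto
  also have "\<dots> = c powr q * K * (\<Sum>x\<in>X. \<Sum>j\<in>{j \<in> (\<Union>x\<in>X. qbox (2 * r) x). j \<in> qbox (2 * r) x}. f j powr q * w j)"
    by (simp add: sum_distrib_left mult.assoc)
      (intro sum.cong refl, auto)
  also have "\<dots> \<le> c powr q * K * (c * ?V r * ?S)"
    using K_pos by (intro mult_left_mono inner) auto
  finally have "?V r * (\<Sum>i\<in>I. avg r f i powr q * w i) \<le> c powr q * K * (c * ?V r * ?S)" .
  then have "?V r * (\<Sum>i\<in>I. avg r f i powr q * w i) \<le> ?V r * ((c powr q * c) * K * ?S)"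
    by (simp add: mult_ac)
  then have "(\<Sum>i\<in>I. avg r f i powr q * w i) \<le> (c powr q * c) * K * ?S"
    by (subst (asm) mult_le_cancel_left_pos) auto
  also have "c powr q * c = c powr (q + 1)" using c by (simp add: powr_add)
  also have "\<dots> = 2 powr (real CARD('d) * (q + 1))"
    by (simp add: c_def powr_realpow[symmetric] powr_powr)
  finally show ?thesis by (simp add: avg_const_def)
qed

text \<open>The index set {i} in \<open>sum_avg_powr_le\<close> bounds the averages at i by one
  number for all radii, because w i > 0; comparison with \<open>e\<close> finishes.\<close>

lemma avg_series_summable:
  assumes f: "\<And>i. 0 \<le> f i" and sm: "(\<lambda>i. f i powr q * w i) summable_on UNIV"
    and e: "\<And>k. 0 \<le> e k" "summable e"
  shows "summable (\<lambda>k. e k * avg (r k) f i)"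
proof -
  let ?B = "(avg_const * (\<Sum>\<^sub>\<infinity>i. f i powr q * w i) / w i) powr (1 / q)"
  have "avg (r k) f i \<le> ?B" for k
  proof -
    have "avg (r k) f i powr q * w i \<le> avg_const * (\<Sum>\<^sub>\<infinity>i. f i powr q * w i)"
      using sum_avg_powr_le[OF f sm, of "{i}"] by simp
    then have "avg (r k) f i powr q \<le> avg_const * (\<Sum>\<^sub>\<infinity>i. f i powr q * w i) / w i"
      using w_pos[of i] by (simp add: pos_le_divide_eq)
    then have "(avg (r k) f i powr q) powr (1 / q) \<le> ?B"
      using q_ge_1 by (intro powr_mono2) auto
    then show ?thesis using q_ge_1 avg_nonneg[of f, OF f] by (simp add: powr_powr)
  qed
  then have "norm (e k * avg (r k) f i) \<le> e k * ?B" for k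
    using e f by (simp add: avg_nonneg mult_left_mono)
  moreover have "summable (\<lambda>k. e k * ?B)" using e by (intro summable_mult2)
  ultimately show ?thesis by (rule summable_comparison_test'[where N = 0, rotated])
qed

text \<open>Jensen with masses \<open>e k\<close> reduces partial sums to the bound for a single
  average, and E^(q-1) * E = E^q collects the total mass E; then the number of terms tends to
  infinity. The norm is thus controlled by the total mass alone, which is what makes absorption
  possible later.\<close>

lemma sum_avg_series_powr_le:
  assumes f: "\<And>i. 0 \<le> f i" and sm: "(\<lambda>i. f i powr q * w i) summable_on UNIV"
    and e: "\<And>k. 0 \<le> e k" "summable e" and I: "finite I"
  shows "(\<Sum>i\<in>I. (\<Sum>k. e k * avg (r k) f i) powr q * w i)
           \<le> avg_const * suminf e powr q * (\<Sum>\<^sub>\<infinity>i. f i powr q * w i)"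
proof -
  let ?S = "\<Sum>\<^sub>\<infinity>i. f i powr q * w i"
  have S0: "0 \<le> ?S" by (intro infsum_nonneg) auto
  have partial: "(\<Sum>i\<in>I. (\<Sum>k<n. e k * avg (r k) f i) powr q * w i) \<le> avg_const * suminf e powr q * ?S"
    (is "?L n \<le> _") for n
  proof -
    let ?E = "sum e {..<n}"
    have E: "0 \<le> ?E" "?E \<le> suminf e" using e by (auto intro: sum_nonneg sum_le_suminf)
    have "?L n \<le> (\<Sum>i\<in>I. ?E powr (q - 1) * (\<Sum>k<n. e k * avg (r k) f i powr q) * w i)"
      using e f q_ge_1 by (intro sum_mono mult_right_mono jensen_powr avg_nonneg) auto
    also have "\<dots> = ?E powr (q - 1) * (\<Sum>i\<in>I. \<Sum>k<n. e k * (avg (r k) f i powr q * w i))"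
      by (simp add: sum_distrib_left sum_distrib_right mult_ac)
    also have "(\<Sum>i\<in>I. \<Sum>k<n. e k * (avg (r k) f i powr q * w i))
        = (\<Sum>k<n. e k * (\<Sum>i\<in>I. avg (r k) f i powr q * w i))"
      by (subst sum.swap) (simp add: sum_distrib_left)
    also have "?E powr (q - 1) * \<dots> \<le> ?E powr (q - 1) * (\<Sum>k<n. e k * (avg_const * ?S))"
      by (intro mult_left_mono sum_mono sum_avg_powr_le f sm e I) auto
    also have "\<dots> = ?E powr (q - 1) * ?E * (avg_const * ?S)"
      by (simp add: sum_distrib_right)
    also have "?E powr (q - 1) * ?E = ?E powr q"
      using E by (cases "?E = 0") (auto simp: powr_diff)
    also have "\<dots> * (avg_const * ?S) \<le> suminf e powr q * (avg_const * ?S)"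
      using E q_ge_1 S0 avg_const_pos by (intro mult_right_mono powr_mono2) auto
    finally show ?thesis by (simp add: mult_ac)
  qed
  have "?L \<longlonglongrightarrow> (\<Sum>i\<in>I. (\<Sum>k. e k * avg (r k) f i) powr q * w i)"
  proof (intro tendsto_sum tendsto_mult tendsto_const tendsto_powr' conjI disjI2)
    fix i
    show "(\<lambda>n. \<Sum>k<n. e k * avg (r k) f i) \<longlonglongrightarrow> (\<Sum>k. e k * avg (r k) f i)"
      by (intro summable_LIMSEQ avg_series_summable f sm e)
    show "\<forall>\<^sub>F n in sequentially. 0 \<le> (\<Sum>k<n. e k * avg (r k) f i)"
      using e f by (intro always_eventually allI sum_nonneg mult_nonneg_nonneg avg_nonneg) auto
  qed (use q_ge_1 in auto)
  then show ?thesis by (rule LIMSEQ_le_const2) (use partial in auto)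
qed

text \<open>Serves to show that the local means of the source weight lie in the target
  space.\<close>

lemma summable_powr_of_le_avg:
  assumes f: "\<And>i. 0 \<le> f i" and sm: "(\<lambda>i. f i powr q * w i) summable_on UNIV"
    and g: "\<And>i. 0 \<le> g i" "\<And>i. g i \<le> a * avg r f i" and a: "0 \<le> a"
  shows "(\<lambda>i. g i powr q * w i) summable_on UNIV"
proof -
  have "(\<Sum>i\<in>I. g i powr q * w i) \<le> a powr q * avg_const * (\<Sum>\<^sub>\<infinity>i. f i powr q * w i)" if "finite I" for I
  proof -
    have "(\<Sum>i\<in>I. g i powr q * w i) \<le> (\<Sum>i\<in>I. (a * avg r f i) powr q * w i)"
    proof (intro sum_mono mult_right_mono w_nonneg)
      fix i
      show "g i powr q \<le> (a * avg r f i) powr q"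
        by (rule powr_mono2) (use q_ge_1 g in simp_all)
    qed
    also have "\<dots> = a powr q * (\<Sum>i\<in>I. avg r f i powr q * w i)"
      using f a by (simp add: powr_mult avg_nonneg sum_distrib_left mult_ac)
    also have "\<dots> \<le> a powr q * (avg_const * (\<Sum>\<^sub>\<infinity>i. f i powr q * w i))"
      by (intro mult_left_mono sum_avg_powr_le f sm that) auto
    finally show ?thesis by (simp add: mult_ac)
  qed
  note bound = this
  have nn: "0 \<le> g i powr q * w i" for i by simp
  show "(\<lambda>i. g i powr q * w i) summable_on UNIV"
    by (rule summable_on_and_infsum_le(1), rule nn, rule bound)
qed

end

text \<open>Every j in the support of the kernel selects one scale k; the series on the right
  contains the contribution of j at that scale among other nonnegative terms. Points where the
  kernel vanishes need no scale, which the far commutator estimate exploits.\<close>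

lemma infsum_kernel_le_avg_series:
  fixes f \<kappa> :: "int ^ 'd::finite \<Rightarrow> real"
  assumes f: "\<And>j. 0 \<le> f j" and e: "\<And>k. 0 \<le> e k"
    and sm: "summable (\<lambda>k. e k * avg (r k) f i)"
    and \<kappa>: "\<And>j. 0 \<le> \<kappa> j"
    and dom: "\<And>j. 0 < \<kappa> j \<Longrightarrow> \<exists>k. j \<in> qbox (r k) i \<and> \<kappa> j \<le> e k / side (r k) ^ CARD('d)"
  shows "(\<lambda>j. \<kappa> j * f j) summable_on UNIV"
    and "(\<Sum>\<^sub>\<infinity>j. \<kappa> j * f j) \<le> (\<Sum>k. e k * avg (r k) f i)"
proof -
  have "(\<Sum>j\<in>J. \<kappa> j * f j) \<le> (\<Sum>k. e k * avg (r k) f i)" if J: "finite J" for J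
  proof -
    let ?a = "\<lambda>k. e k / side (r k) ^ CARD('d)"
    define kk where "kk j = (SOME k. j \<in> qbox (r k) i \<and> \<kappa> j \<le> ?a k)" for j
    have kk: "j \<in> qbox (r (kk j)) i \<and> \<kappa> j \<le> ?a (kk j)" if "0 < \<kappa> j" for j
      unfolding kk_def by (rule someI_ex[OF dom[OF that]])
    \<comment> \<open>Beyond all scales selected by the finitely many j, so that sums over j and k
      can be interchanged as finite sums.\<close>
    define n where "n = Suc (Max (insert 0 (kk ` J)))"
    have n: "kk j < n" if "j \<in> J" for j
      using J that by (simp add: n_def less_Suc_eq_le)
    have le: "\<kappa> j * f j \<le> (\<Sum>k\<in>{k \<in> {..<n}. j \<in> qbox (r k) i}. ?a k * f j)" (is "_ \<le> ?R") if "j \<in> J" for j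
    proof (cases "0 < \<kappa> j")
      case True
      have "\<kappa> j * f j \<le> ?a (kk j) * f j" using kk[OF True] f by (intro mult_right_mono) auto
      also have "\<dots> \<le> ?R"
        using kk[OF True] n[OF that] e f by (intro member_le_sum) auto
      finally show ?thesis .
    next
      case False
      then have "\<kappa> j = 0" using \<kappa>[of j] by simp
      then show ?thesis using e f by (auto intro!: sum_nonneg)
    qed
    have "(\<Sum>j\<in>J. \<kappa> j * f j) \<le> (\<Sum>j\<in>J. \<Sum>k\<in>{k \<in> {..<n}. j \<in> qbox (r k) i}. ?a k * f j)"
      by (intro sum_mono le)
    also have "\<dots> = (\<Sum>k<n. \<Sum>j\<in>{j \<in> J. j \<in> qbox (r k) i}. ?a k * f j)"
      using J by (intro sum.swap_restrict) auto
    also have "\<dots> \<le> (\<Sum>k<n. e k * avg (r k) f i)"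
    proof (rule sum_mono)
      fix k
      have "(\<Sum>j\<in>{j \<in> J. j \<in> qbox (r k) i}. ?a k * f j) \<le> (\<Sum>j\<in>qbox (r k) i. ?a k * f j)"
        using e f by (intro sum_mono2) auto
      also have "\<dots> = e k * avg (r k) f i" by (simp add: avg_def sum_distrib_left sum_divide_distrib)
      finally show "(\<Sum>j\<in>{j \<in> J. j \<in> qbox (r k) i}. ?a k * f j) \<le> e k * avg (r k) f i" .
    qed
    also have "\<dots> \<le> (\<Sum>k. e k * avg (r k) f i)"
      using e f by (intro sum_le_suminf sm) (auto intro!: mult_nonneg_nonneg avg_nonneg)
    finally show ?thesis .
  qed
  note bound = this
  have nn: "0 \<le> \<kappa> j * f j" for j using \<kappa> f by simp
  show "(\<lambda>j. \<kappa> j * f j) summable_on UNIV"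
    by (rule summable_on_and_infsum_le(1), rule nn, rule bound)
  show "(\<Sum>\<^sub>\<infinity>j. \<kappa> j * f j) \<le> (\<Sum>k. e k * avg (r k) f i)"
    by (rule summable_on_and_infsum_le(2), rule nn, rule bound)
qed

subsection \<open>Dyadic majorants and local means\<close>

text \<open>The least k with m below 2^k. For k = 0 the lower bound \<open>2 ^ k div 2\<close> is 0,
  so m = 0 is covered; for k > 0 it is 2^(k-1).\<close>

lemma ex_dyadic_scale: "\<exists>k. 2 ^ k div 2 \<le> m \<and> m \<le> (2 ^ k :: nat)"
proof -
  define k where "k = (LEAST k. m \<le> 2 ^ k)"
  have "m \<le> 2 ^ m" by (simp add: less_imp_le)
  then have le: "m \<le> 2 ^ k" unfolding k_def by (rule LeastI)
  have "2 ^ k div 2 \<le> m"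
  proof (cases k)
    case (Suc l)
    then have "\<not> m \<le> 2 ^ l" unfolding k_def by (intro not_less_Least) simp
    then show ?thesis using Suc by simp
  qed simp
  with le show ?thesis by blast
qed

text \<open>Cauchy condensation: the radial majorant h is decreasing, so its sum over the lattice
  controls the sum over k of h(2^(k-1)) times the volume of the ball of radius 2^k.\<close>

lemma B_class_dyadic_majorant:
  fixes A :: "'d::finite lattice_matrix"
  assumes "A \<in> B_class"
  obtains e :: "nat \<Rightarrow> real" where "\<And>k. 0 \<le> e k" "summable e"
    "\<And>k i j. int (2 ^ k div 2) \<le> maxnorm (i - j) \<Longrightarrow> cmod (A i j) \<le> e k / side (2 ^ k) ^ CARD('d)"
proof -
  define H where "H m = (SUP (i, j) \<in> {(i, j). maxnorm (i - j) \<ge> m}. ennreal (cmod (A i j)))" for m :: int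
  define h where "h m = enn2real (H m)" for m
  define b where "b = enn2real (B_norm A)"
  have B: "B_norm A = (\<Sum>\<^sub>\<infinity>k::int ^ 'd. H (maxnorm k))" by (simp add: B_norm_def H_def)
  have fin: "B_norm A < \<infinity>" using assms by (simp add: B_class_def)
  have anti: "H n \<le> H m" if "m \<le> n" for m n
    unfolding H_def by (rule SUP_subset_mono) (use that in auto)
  have sumH: "(\<Sum>x\<in>X. H (maxnorm x)) \<le> B_norm A" if "finite X" for X :: "(int ^ 'd) set"
    unfolding B by (subst nonneg_infsum_complete) (auto intro!: SUP_upper that)
  have m0: "maxnorm (0 :: int ^ 'd) = 0" by (simp add: maxnorm_def)
  have "H 0 \<le> B_norm A" using sumH[of "{0}"] by (simp add: m0)
  then have H_fin: "H m < \<infinity>" if "0 \<le> m" for m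
    using anti[OF that] fin by (metis le_less_trans)
  have h_H: "ennreal (h m) = H m" if "0 \<le> m" for m
    using H_fin[OF that] by (simp add: h_def less_top)
  have h0: "0 \<le> h m" for m by (simp add: h_def)
  have h_anti: "h n \<le> h m" if "m \<le> n" "0 \<le> m" for m n
    unfolding h_def using anti[OF that(1)] H_fin[OF that(2)] by (intro enn2real_mono) auto
  have sumh: "(\<Sum>x\<in>X. h (maxnorm x)) \<le> b" if "finite X" for X :: "(int ^ 'd) set"
  proof -
    have "ennreal (\<Sum>x\<in>X. h (maxnorm x)) = (\<Sum>x\<in>X. H (maxnorm x))"
      by (subst sum_ennreal[symmetric]) (auto simp: h0 h_H maxnorm_nonneg)
    also have "\<dots> \<le> ennreal b" using sumH[OF that] fin by (simp add: b_def less_top)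
    finally show ?thesis by (subst (asm) ennreal_le_iff) (auto simp: b_def)
  qed
  define e where "e k = h (int (2 ^ k div 2)) * side (2 ^ k) ^ CARD('d)" for k
  \<comment> \<open>Disjoint cubes in the positive orthant with coordinates in (2^l, 2^(l+1)]. Each
    has 2^(l d) points, all of norm at most 2^(l+1), hence with h at least h(2^(l+1)).\<close>
  define X :: "nat \<Rightarrow> (int ^ 'd) set" where "X l = cube (\<chi> _. 2 ^ l + 1) (2 ^ l)" for l
  have X: "2 ^ l < x $ m \<and> x $ m \<le> 2 ^ Suc l" if "x \<in> X l" for x l m
  proof -
    have "2 ^ l + 1 \<le> x $ m \<and> x $ m \<le> 2 ^ l + 1 + (int (2 ^ l) - 1)"
      using that unfolding X_def cube_def by simp
    then show ?thesis by simp
  qed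
  have disj: "X l \<inter> X l' = {}" if "l < l'" for l l'
  proof (rule equals0I)
    fix x assume x: "x \<in> X l \<inter> X l'"
    \<comment> \<open>One coordinate already separates the cubes; \<open>undefined\<close> serves as
      an arbitrary index.\<close>
    have "x $ undefined \<le> 2 ^ Suc l" "(2 :: int) ^ l' < x $ undefined"
      using X[of x l undefined] X[of x l' undefined] x by auto
    moreover have "(2 :: int) ^ Suc l \<le> 2 ^ l'" using that by (intro power_increasing) auto
    ultimately show False by linarith
  qed
  \<comment> \<open>The shift by 2 aligns \<open>e\<close> with the cubes: \<open>e (l + 2)\<close>
    involves h(2^(l+1)) and the side 8 * 2^l + 1, at most 9 * 2^l.\<close>
  have "(\<Sum>l<n. e (l + 2)) \<le> 9 ^ CARD('d) * b" for n
  proof -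
    have "(\<Sum>l<n. e (l + 2)) \<le> (\<Sum>l<n. 9 ^ CARD('d) * (\<Sum>x\<in>X l. h (maxnorm x)))"
    proof (rule sum_mono)
      fix l
      have s: "side (2 ^ (l + 2)) \<le> 9 * 2 ^ l" by (simp add: side_def)
      have "e (l + 2) = h (2 ^ Suc l) * side (2 ^ (l + 2)) ^ CARD('d)"
        by (simp add: e_def)
      also have "\<dots> \<le> h (2 ^ Suc l) * (9 * 2 ^ l) ^ CARD('d)"
        using s by (intro mult_left_mono power_mono h0) auto
      also have "\<dots> = 9 ^ CARD('d) * (\<Sum>x\<in>X l. h (2 ^ Suc l))"
        by (simp add: X_def card_cube power_mult_distrib)
      also have "\<dots> \<le> 9 ^ CARD('d) * (\<Sum>x\<in>X l. h (maxnorm x))"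
      proof (intro mult_left_mono sum_mono h_anti maxnorm_nonneg)
        fix x assume x: "x \<in> X l"
        have "\<bar>x $ m\<bar> \<le> 2 ^ Suc l" for m
        proof -
          have "0 < x $ m" using X[OF x, of m] by (smt (verit) zero_less_power)
          then show ?thesis using X[OF x, of m] by simp
        qed
        then show "maxnorm x \<le> 2 ^ Suc l" by (simp only: maxnorm_le_iff) simp
      qed simp
      finally show "e (l + 2) \<le> 9 ^ CARD('d) * (\<Sum>x\<in>X l. h (maxnorm x))" .
    qed
    also have "\<dots> = 9 ^ CARD('d) * (\<Sum>x\<in>(\<Union>l<n. X l). h (maxnorm x))"
      unfolding sum_distrib_left[symmetric]
    proof (subst sum.UNION_disjoint)
      show "\<forall>i\<in>{..<n}. \<forall>j\<in>{..<n}. i \<noteq> j \<longrightarrow> X i \<inter> X j = {}"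
        using disj by (metis inf_commute linorder_neqE_nat)
    qed (auto simp: X_def)
    also have "\<dots> \<le> 9 ^ CARD('d) * b"
      by (intro mult_left_mono sumh) (auto simp: X_def)
    finally show ?thesis .
  qed
  then have "summable (\<lambda>l. e (l + 2))"
    by (intro summableI_nonneg_bounded) (auto simp: e_def h0)
  then have "summable e" by (subst (asm) summable_iff_shift)
  moreover have "0 \<le> e k" for k by (simp add: e_def h0)
  moreover have "cmod (A i j) \<le> e k / side (2 ^ k) ^ CARD('d)" if "int (2 ^ k div 2) \<le> maxnorm (i - j)" for k i j
  proof -
    have "ennreal (cmod (A i j)) \<le> H (int (2 ^ k div 2))"
      unfolding H_def by (rule SUP_upper2[of "(i, j)"]) (use that in auto)
    then have "cmod (A i j) \<le> h (int (2 ^ k div 2))"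
      by (subst (asm) h_H[symmetric]) (auto simp: h0)
    then show ?thesis by (simp add: e_def)
  qed
  ultimately show ?thesis using that by blast
qed

text \<open>Dominated convergence for series: each term is O(2^(-M)) for fixed k and is dominated by
  \<open>e k\<close>.\<close>

lemma tendsto_damped_suminf:
  fixes e :: "nat \<Rightarrow> real"
  assumes e: "\<And>k. 0 \<le> e k" "summable e"
  shows "(\<lambda>M. \<Sum>k. e k * min 1 (2 ^ k / 2 ^ M)) \<longlonglongrightarrow> 0"
proof -
  have "(\<lambda>M. \<Sum>k. e k * min 1 (2 ^ k / 2 ^ M)) \<longlonglongrightarrow> (\<Sum>k. 0)"
  proof (rule tannerys_theorem[THEN conjunct2, THEN conjunct2])
    fix k
    show "(\<lambda>M. e k * min 1 (2 ^ k / 2 ^ M)) \<longlonglongrightarrow> 0"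
    proof (rule Lim_null_comparison)
      have "norm (e k * min 1 (2 ^ k / 2 ^ M)) \<le> e k * 2 ^ k * (1 / 2) ^ M" for M
      proof -
        have "norm (e k * min 1 (2 ^ k / 2 ^ M)) = e k * min 1 (2 ^ k / 2 ^ M)"
          using e(1)[of k] by simp
        also have "\<dots> \<le> e k * (2 ^ k / 2 ^ M)"
          using e(1) by (intro mult_left_mono min.cobounded2)
        finally show ?thesis by (simp add: power_divide)
      qed
      then show "\<forall>\<^sub>F M in sequentially. norm (e k * min 1 (2 ^ k / 2 ^ M)) \<le> e k * 2 ^ k * (1 / 2) ^ M"
        by (intro always_eventually) blast
      show "(\<lambda>M. e k * 2 ^ k * (1 / 2) ^ M) \<longlonglongrightarrow> 0"
        by (intro tendsto_mult_right_zero LIMSEQ_realpow_zero) auto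
    qed
  next
    show "\<forall>\<^sub>F (k, M) in at_top \<times>\<^sub>F sequentially. norm (e k * min 1 (2 ^ k / 2 ^ M)) \<le> e k"
      using e by (intro always_eventually) (auto simp: abs_mult intro: mult_left_le)
  qed (use e in auto)
  then show ?thesis by simp
qed

section \<open>Doubling of weights and local means\<close>

context aq_weight
begin

text \<open>The weight condition on the large ball, tested on the indicator of the small
  one.\<close>

lemma sum_w_qbox_le:
  assumes "r \<le> R" "side R \<le> a * side r"
  shows "sum w (qbox R x) \<le> K * (a ^ CARD('d)) powr q * sum w (qbox r x)"
proof -
  let ?f = "\<lambda>i. if i \<in> qbox r x then 1 else 0 :: real"
  let ?u = "(side r / side R) ^ CARD('d)"
  have sub: "qbox R x \<inter> qbox r x = qbox r x" using qbox_mono[OF assms(1)] by auto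
  have a: "0 < a" using assms(2) by (metis less_le_trans side_pos zero_less_mult_pos2)
  have "avg R ?f x = ?u"
    by (simp add: avg_def sum.If_cases sub card_qbox power_divide)
  moreover have "(\<Sum>i\<in>qbox R x. ?f i powr q * w i) = sum w (qbox r x)"
  proof -
    have "(\<Sum>i\<in>qbox R x. ?f i powr q * w i) = (\<Sum>i\<in>qbox R x. if i \<in> qbox r x then w i else 0)"
      by (intro sum.cong) auto
    then show ?thesis by (simp add: sum.If_cases sub)
  qed
  ultimately have 1: "?u powr q * sum w (qbox R x) \<le> K * sum w (qbox r x)"
    using avg_powr_le[of ?f R x] by simp
  have "1 \<le> a * (side r / side R)" using assms(2) by (simp add: pos_le_divide_eq)
  then have "1 \<le> (a ^ CARD('d)) * ?u"
    by (metis one_le_power power_mult_distrib)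
  then have "1 \<le> ((a ^ CARD('d)) * ?u) powr q"
    using q_ge_1 by (intro ge_one_powr_ge_zero) auto
  also have "\<dots> = (a ^ CARD('d)) powr q * ?u powr q" using a by (simp add: powr_mult)
  finally have "1 * sum w (qbox R x) \<le> ((a ^ CARD('d)) powr q * ?u powr q) * sum w (qbox R x)"
    by (intro mult_right_mono) (auto intro: sum_nonneg)
  also have "\<dots> \<le> (a ^ CARD('d)) powr q * (K * sum w (qbox r x))"
    unfolding mult.assoc by (intro mult_left_mono 1) auto
  finally show ?thesis by (simp add: mult_ac)
qed

definition local_mean :: "nat \<Rightarrow> (int ^ 'd \<Rightarrow> real) \<Rightarrow> int ^ 'd \<Rightarrow> real" where
  "local_mean N f n = ((\<Sum>i\<in>qbox N n. f i powr q * w i) / sum w (qbox N n)) powr (1 / q)"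

lemma local_mean_nonneg [simp]: "0 \<le> local_mean N f n"
  by (simp add: local_mean_def)

lemma local_mean_powr: "local_mean N f n powr q * sum w (qbox N n) = (\<Sum>i\<in>qbox N n. f i powr q * w i)"
proof -
  have "0 \<le> (\<Sum>i\<in>qbox N n. f i powr q * w i) / sum w (qbox N n)"
    by (intro divide_nonneg_pos sum_nonneg) auto
  then have "local_mean N f n powr q = (\<Sum>i\<in>qbox N n. f i powr q * w i) / sum w (qbox N n)"
    unfolding local_mean_def powr_powr using q_ge_1 by (simp del: abs_divide)
  moreover have "sum w (qbox N n) \<noteq> 0" using sum_w_pos[of N n] by linarith
  ultimately show ?thesis by simp
qed

lemma le_of_weighted_powr_le:
  assumes "a powr q * W \<le> C * b powr q * W" "0 < W" "0 \<le> a" "0 \<le> b" "0 \<le> C"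
  shows "a \<le> C powr (1 / q) * b"
proof -
  have "a powr q \<le> C * b powr q" using assms by simp
  then have "(a powr q) powr (1 / q) \<le> (C * b powr q) powr (1 / q)"
    using q_ge_1 by (intro powr_mono2) auto
  then show ?thesis using assms q_ge_1 by (simp add: powr_powr powr_mult)
qed

lemma avg_le_local_mean:
  assumes "\<And>i. 0 \<le> f i"
  shows "avg N f n \<le> K powr (1 / q) * local_mean N f n"
  by (rule le_of_weighted_powr_le[of _ "sum w (qbox N n)"])
    (use avg_powr_le[where r = N and x = n, OF assms] K_pos assms in \<open>simp_all add: local_mean_powr mult.assoc avg_nonneg\<close>)

text \<open>A crude bound of each term by the whole sum. The power of N lost in this way is
  harmless: it multiplies the term with \<open>mat_apply A c\<close> or serves for mere finiteness,
  and never meets the terms to be absorbed.\<close>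

lemma sum_powr_le_powr_sum:
  assumes "\<And>i. 0 \<le> f i"
  shows "(\<Sum>i\<in>qbox N n. f i powr q * w i) \<le> sum f (qbox N n) powr q * sum w (qbox N n)"
proof -
  have "f i powr q \<le> sum f (qbox N n) powr q" if "i \<in> qbox N n" for i
    using assms q_ge_1 that by (intro powr_mono2 member_le_sum) auto
  then show ?thesis by (auto simp: sum_distrib_left intro!: sum_mono mult_right_mono)
qed

lemma local_mean_le_avg:
  assumes "\<And>i. 0 \<le> f i"
  shows "local_mean N f n \<le> side N ^ CARD('d) * avg N f n"
proof -
  have "local_mean N f n \<le> 1 powr (1 / q) * sum f (qbox N n)"
    by (rule le_of_weighted_powr_le[of _ "sum w (qbox N n)"])
      (use sum_powr_le_powr_sum[where N = N and n = n, OF assms] assms in \<open>simp_all add: local_mean_powr sum_nonneg\<close>)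
  then show ?thesis by (simp add: sum_qbox_eq_avg)
qed

lemma le_local_mean:
  assumes "\<And>i. 0 \<le> f i"
  shows "f n \<le> side N ^ CARD('d) * K powr (1 / q) * local_mean N f n"
proof -
  have "f n \<le> sum f (qbox N n)" using assms by (intro member_le_sum) auto
  also have "\<dots> = side N ^ CARD('d) * avg N f n" by (rule sum_qbox_eq_avg)
  also have "\<dots> \<le> side N ^ CARD('d) * (K powr (1 / q) * local_mean N f n)"
    by (intro mult_left_mono avg_le_local_mean assms) auto
  finally show ?thesis by (simp add: mult.assoc)
qed

text \<open>Each point j of the R-ball is counted through the N-balls containing it, whose centres
  stay within 2R of n because N is at most R. The constant does not depend on N, as needed for a
  term that is to be absorbed.\<close>

lemma avg_le_avg_local_mean:
  assumes f: "\<And>i. 0 \<le> f i" and "N \<le> R"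
  shows "avg R f n \<le> 2 ^ CARD('d) * K powr (1 / q) * avg (2 * R) (local_mean N f) n"
proof -
  let ?V = "\<lambda>r. side r ^ CARD('d)"
  let ?X = "qbox (2 * R) n"
  have "?V N * sum f (qbox R n) = (\<Sum>j\<in>qbox R n. \<Sum>x\<in>qbox N j. f j)"
    by (simp add: card_qbox sum_distrib_left)
  also have "\<dots> = (\<Sum>j\<in>qbox R n. \<Sum>x\<in>{x \<in> ?X. x \<in> qbox N j}. f j)"
  proof (intro sum.cong refl)
    fix j assume j: "j \<in> qbox R n"
    show "qbox N j = {x \<in> ?X. x \<in> qbox N j}"
      using qbox_trans[OF _ j, of _ N "2 * R"] assms(2) by auto
  qed
  also have "\<dots> = (\<Sum>x\<in>?X. \<Sum>j\<in>{j \<in> qbox R n. x \<in> qbox N j}. f j)"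
    by (rule sum.swap_restrict) auto
  also have "\<dots> \<le> (\<Sum>x\<in>?X. ?V N * (K powr (1 / q) * local_mean N f x))"
  proof (rule sum_mono)
    fix x
    have "(\<Sum>j\<in>{j \<in> qbox R n. x \<in> qbox N j}. f j) \<le> sum f (qbox N x)"
      using f by (intro sum_mono2) (auto simp: qbox_commute)
    also have "\<dots> \<le> ?V N * (K powr (1 / q) * local_mean N f x)"
      unfolding sum_qbox_eq_avg by (intro mult_left_mono avg_le_local_mean f) auto
    finally show "(\<Sum>j\<in>{j \<in> qbox R n. x \<in> qbox N j}. f j) \<le> ?V N * (K powr (1 / q) * local_mean N f x)" .
  qed
  also have "\<dots> = ?V N * (K powr (1 / q) * sum (local_mean N f) ?X)"
    by (simp add: sum_distrib_left)
  finally have "sum f (qbox R n) \<le> K powr (1 / q) * sum (local_mean N f) ?X"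
    by (subst (asm) mult_le_cancel_left_pos) auto
  then have "?V R * avg R f n \<le> K powr (1 / q) * (?V (2 * R) * avg (2 * R) (local_mean N f) n)"
    by (simp only: sum_qbox_eq_avg)
  also have "\<dots> \<le> K powr (1 / q) * ((2 ^ CARD('d) * ?V R) * avg (2 * R) (local_mean N f) n)"
    using power_mono[OF side_mult_le[of 2 R], of "CARD('d)"]
    by (intro mult_left_mono mult_right_mono avg_nonneg) (auto simp: power_mult_distrib)
  finally have "?V R * avg R f n \<le> ?V R * (2 ^ CARD('d) * K powr (1 / q) * avg (2 * R) (local_mean N f) n)"
    by (simp add: mult_ac)
  then show ?thesis by (subst (asm) mult_le_cancel_left_pos) auto
qed

text \<open>Here 9^d counts the tiles of side N, 17 bounds \<open>side (8 * N)\<close> by 17 N, and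
  6 comes from comparing the weights of balls of radii 6N and N.\<close>

definition cover_const :: real where
  "cover_const = 9 ^ CARD('d) * (17 ^ CARD('d)) powr q * (K * (6 ^ CARD('d)) powr q)"

text \<open>
  On a cube of side \<open>N\<close> the weighted sum of \<open>f\<close> is dominated by the local mean at \<^emph>\<open>every\<close> point
  of that cube, hence by the average of the local means. This is what turns the \<open>q\<close>-sum on the left
  into an ordinary average on the right, independently of the relation between \<open>q\<close> and the
  target exponent.
\<close>

lemma sum_powr_le_avg_local_mean:
  assumes f: "\<And>i. 0 \<le> f i" and N: "1 \<le> N"
  shows "(\<Sum>i\<in>qbox (4 * N) n. f i powr q * w i)
           \<le> cover_const * avg (8 * N) (local_mean N f) n powr q * sum w (qbox N n)"
proof -
  let ?m = "local_mean N f" and ?W = "sum w (qbox N n)"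
  let ?a = "avg (8 * N) ?m n"
  let ?F = "\<lambda>i. f i powr q * w i"
  define T :: "(int ^ 'd) set" where "T = qbox 4 0"
  \<comment> \<open>Tiling by cubes \<open>Q t\<close> of side N with corner n + N t;
    \<open>g j\<close> is the index of the tile containing j. Within distance 4N of n, floor
    division gives coordinates between -4 and 4, whence \<open>T\<close>.\<close>
  define g :: "int ^ 'd \<Rightarrow> int ^ 'd" where "g j = (\<chi> m. (j $ m - n $ m) div int N)" for j
  define Q where "Q t = cube (\<chi> m. n $ m + int N * t $ m) N" for t :: "int ^ 'd"
  have T: "finite T" "real (card T) = 9 ^ CARD('d)" by (simp_all add: T_def card_qbox side_def)
  have Ti: "\<bar>t $ m\<bar> \<le> 4" if "t \<in> T" for t m
    using that by (auto simp: T_def qbox_def maxnorm_le_iff)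
  have gT: "g ` qbox (4 * N) n \<subseteq> T"
  proof
    fix t assume "t \<in> g ` qbox (4 * N) n"
    then obtain j where j: "j \<in> qbox (4 * N) n" "t = g j" by blast
    have "\<bar>(j $ m - n $ m) div int N\<bar> \<le> 4" for m
    proof -
      have "\<bar>j $ m - n $ m\<bar> \<le> 4 * int N" using j(1) by (auto simp: qbox_def maxnorm_le_iff)
      then have "- 4 * int N \<le> j $ m - n $ m" "j $ m - n $ m \<le> 4 * int N" by linarith+
      then have "(- 4 * int N) div int N \<le> (j $ m - n $ m) div int N"
        "(j $ m - n $ m) div int N \<le> (4 * int N) div int N"
        using N by (simp_all only: zdiv_mono1 of_nat_0_less_iff)
      moreover have "(- 4 * int N) div int N = - 4" "(4 * int N) div int N = 4"
        using N by (auto simp only: nonzero_mult_div_cancel_right)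
      ultimately show ?thesis by linarith
    qed
    then show "t \<in> T" by (simp add: T_def qbox_def maxnorm_le_iff j(2) g_def)
  qed
  have piece: "sum ?F {i \<in> qbox (4 * N) n. g i = t} \<le> (17 ^ CARD('d) * ?a) powr q * (K * (6 ^ CARD('d)) powr q * ?W)"
    if t: "t \<in> T" for t
  proof -
    have fin: "finite (Q t)" by (simp add: Q_def)
    have card: "card (Q t) = N ^ CARD('d)" by (simp add: Q_def card_cube)
    then have ne: "Q t \<noteq> {}" using N by auto
    \<comment> \<open>A point of the tile with least local mean: that value is at most the average
      over the tile, while the tile lies in the N-ball about y.\<close>
    obtain y where y: "y \<in> Q t" "\<And>z. z \<in> Q t \<Longrightarrow> ?m y \<le> ?m z"
      using ex_min_if_finite[of "?m ` Q t"] fin ne by (force simp: not_less)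
    have fib: "{i \<in> qbox (4 * N) n. g i = t} \<subseteq> Q t"
    proof
      fix j assume j: "j \<in> {i \<in> qbox (4 * N) n. g i = t}"
      have "n $ m + int N * t $ m \<le> j $ m \<and> j $ m \<le> n $ m + int N * t $ m + (int N - 1)" for m
      proof -
        have t: "t $ m = (j $ m - n $ m) div int N" using j by (auto simp: g_def)
        have "int N * ((j $ m - n $ m) div int N) + (j $ m - n $ m) mod int N = j $ m - n $ m"
          by simp
        moreover have "0 \<le> (j $ m - n $ m) mod int N" "(j $ m - n $ m) mod int N < int N"
          using N by auto
        ultimately show ?thesis unfolding t by linarith
      qed
      then show "j \<in> Q t" by (simp add: Q_def cube_def)
    qed
    have Qy: "Q t \<subseteq> qbox N y"
    proof
      fix z assume z: "z \<in> Q t"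
      have "\<bar>z $ m - y $ m\<bar> \<le> int N" for m
      proof -
        have "n $ m + int N * t $ m \<le> z $ m" "z $ m \<le> n $ m + int N * t $ m + (int N - 1)"
          "n $ m + int N * t $ m \<le> y $ m" "y $ m \<le> n $ m + int N * t $ m + (int N - 1)"
          using z y(1) by (auto simp: Q_def cube_def)
        then show ?thesis by linarith
      qed
      then show "z \<in> qbox N y" by (simp add: qbox_def maxnorm_le_iff)
    qed
    have Qn: "Q t \<subseteq> qbox (5 * N) n"
    proof
      fix z assume z: "z \<in> Q t"
      have "\<bar>z $ m - n $ m\<bar> \<le> int (5 * N)" for m
      proof -
        have "n $ m + int N * t $ m \<le> z $ m" "z $ m \<le> n $ m + int N * t $ m + (int N - 1)"
          using z by (auto simp: Q_def cube_def)
        moreover have "\<bar>int N * t $ m\<bar> \<le> int N * 4"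
          unfolding abs_mult using Ti[OF t, of m] by (intro mult_mono) auto
        ultimately have "\<bar>z $ m - n $ m\<bar> \<le> 5 * int N" by linarith
        then show ?thesis by simp
      qed
      then show "z \<in> qbox (5 * N) n" by (simp add: qbox_def maxnorm_le_iff)
    qed
    have "real N ^ CARD('d) * ?m y = (\<Sum>z\<in>Q t. ?m y)" by (simp add: card)
    also have "\<dots> \<le> sum ?m (Q t)" by (intro sum_mono y)
    also have "\<dots> \<le> sum ?m (qbox (8 * N) n)"
      using Qn qbox_mono[of "5 * N" "8 * N" n] by (intro sum_mono2) auto
    also have "\<dots> \<le> (17 * real N) ^ CARD('d) * ?a"
      unfolding sum_qbox_eq_avg using N
      by (intro mult_right_mono power_mono avg_nonneg) (auto simp: side_def)
    finally have "real N ^ CARD('d) * ?m y \<le> real N ^ CARD('d) * (17 ^ CARD('d) * ?a)"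
      by (simp add: power_mult_distrib mult_ac)
    then have my: "?m y \<le> 17 ^ CARD('d) * ?a"
      using N by (subst (asm) mult_le_cancel_left_pos) auto
    \<comment> \<open>The point y is within 5N of n, so its N-ball lies in the 6N-ball about n, and
      doubling returns to radius N.\<close>
    have wy: "sum w (qbox N y) \<le> K * (6 ^ CARD('d)) powr q * ?W"
    proof -
      have "qbox N y \<subseteq> qbox (6 * N) n"
        using y(1) Qn by (auto intro: qbox_trans)
      then have "sum w (qbox N y) \<le> sum w (qbox (6 * N) n)" by (intro sum_mono2) auto
      also have "\<dots> \<le> K * (6 ^ CARD('d)) powr q * ?W"
        using side_mult_le[of 6 N] by (intro sum_w_qbox_le) auto
      finally show ?thesis .
    qed
    have "sum ?F {i \<in> qbox (4 * N) n. g i = t} \<le> sum ?F (qbox N y)"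
      using fib Qy by (intro sum_mono2) auto
    also have "\<dots> = ?m y powr q * sum w (qbox N y)" by (simp add: local_mean_powr)
    also have "\<dots> \<le> (17 ^ CARD('d) * ?a) powr q * (K * (6 ^ CARD('d)) powr q * ?W)"
      using q_ge_1 by (intro mult_mono powr_mono2 my wy) (auto intro: sum_nonneg)
    finally show ?thesis .
  qed
  have "sum ?F (qbox (4 * N) n) = (\<Sum>t\<in>T. sum ?F {i \<in> qbox (4 * N) n. g i = t})"
    using T gT by (intro sum.group[symmetric]) auto
  also have "\<dots> \<le> (\<Sum>t\<in>T. (17 ^ CARD('d) * ?a) powr q * (K * (6 ^ CARD('d)) powr q * ?W))"
    by (intro sum_mono piece)
  also have "\<dots> = cover_const * ?a powr q * ?W"
    by (simp add: T cover_const_def powr_mult avg_nonneg)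
  finally show ?thesis .
qed

end

subsection \<open>Cutoffs and commutators\<close>

lemma powr_add3_le:
  fixes a b c q :: real
  assumes "0 \<le> a" "0 \<le> b" "0 \<le> c" "0 \<le> q"
  shows "(a + b + c) powr q \<le> 3 powr q * (a powr q + b powr q + c powr q)"
proof -
  define m where "m = max a (max b c)"
  have "(a + b + c) powr q \<le> (3 * m) powr q"
    using assms by (intro powr_mono2) (auto simp: m_def)
  also have "\<dots> = 3 powr q * m powr q" using assms by (simp add: powr_mult m_def)
  also have "m powr q \<le> a powr q + b powr q + c powr q" by (auto simp: m_def max_def)
  finally show ?thesis by simp
qed

text \<open>Powers of norms are plain sums, so roots disappear. Only finiteness and the lower
  estimate are kept; the upper estimate in the target space will come from the decay of
  \<open>A\<close>.\<close>

lemma lq_stableD: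
  assumes "lq_stable q w A" "1 \<le> q" "\<And>i. 0 \<le> w i"
  obtains C where "0 < C" "\<And>u. u \<in> weighted_lq q w \<Longrightarrow>
      (\<lambda>i. cmod (mat_apply A u i) powr q * w i) summable_on UNIV \<and>
      (\<Sum>\<^sub>\<infinity>i. cmod (u i) powr q * w i) \<le> C * (\<Sum>\<^sub>\<infinity>i. cmod (mat_apply A u i) powr q * w i)"
proof -
  obtain C where C: "0 < C" and stab: "\<And>u. u \<in> weighted_lq q w \<Longrightarrow>
      mat_apply A u \<in> weighted_lq q w \<and> inverse C * lq_norm q w u \<le> lq_norm q w (mat_apply A u)"
    using assms(1) unfolding lq_stable_def by blast
  have norm_powr: "lq_norm q w u powr q = (\<Sum>\<^sub>\<infinity>i. cmod (u i) powr q * w i)" for u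
  proof -
    have "0 \<le> (\<Sum>\<^sub>\<infinity>i. cmod (u i) powr q * w i)" using assms by (intro infsum_nonneg) auto
    then show ?thesis using assms by (simp add: lq_norm_def powr_powr)
  qed
  have norm_nonneg: "0 \<le> lq_norm q w u" for u by (simp add: lq_norm_def)
  show ?thesis
  proof (rule that)
    show "0 < C powr q" using C by simp
    fix u assume u: "u \<in> weighted_lq q w"
    have "lq_norm q w u \<le> C * lq_norm q w (mat_apply A u)"
      using stab[OF u] C by (simp add: field_simps)
    then have "lq_norm q w u powr q \<le> (C * lq_norm q w (mat_apply A u)) powr q"
      using assms norm_nonneg by (intro powr_mono2) auto
    also have "\<dots> = C powr q * lq_norm q w (mat_apply A u) powr q"
      using C norm_nonneg by (simp add: powr_mult)
    finally show "(\<lambda>i. cmod (mat_apply A u i) powr q * w i) summable_on UNIV \<and>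
      (\<Sum>\<^sub>\<infinity>i. cmod (u i) powr q * w i) \<le> C powr q * (\<Sum>\<^sub>\<infinity>i. cmod (mat_apply A u i) powr q * w i)"
      using stab[OF u] by (simp add: norm_powr weighted_lq_def)
  qed
qed

lemma lq_stableI:
  assumes q: "1 \<le> q" and w: "\<And>i. 0 \<le> w i" and B: "0 \<le> B1" "0 \<le> B2"
    and sm: "\<And>c i. c \<in> weighted_lq q w \<Longrightarrow> (\<lambda>j. A i j * c j) summable_on UNIV"
    and mem: "\<And>c. c \<in> weighted_lq q w \<Longrightarrow> mat_apply A c \<in> weighted_lq q w"
    and lower: "\<And>c. c \<in> weighted_lq q w \<Longrightarrow>
      (\<Sum>\<^sub>\<infinity>i. cmod (c i) powr q * w i) \<le> B1 * (\<Sum>\<^sub>\<infinity>i. cmod (mat_apply A c i) powr q * w i)"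
    and upper: "\<And>c. c \<in> weighted_lq q w \<Longrightarrow>
      (\<Sum>\<^sub>\<infinity>i. cmod (mat_apply A c i) powr q * w i) \<le> B2 * (\<Sum>\<^sub>\<infinity>i. cmod (c i) powr q * w i)"
  shows "lq_stable q w A"
proof -
  define B where "B = max 1 (max B1 B2)"
  define C where "C = B powr (1 / q)"
  have C: "0 < C" by (simp add: C_def B_def)
  have root: "a powr (1 / q) \<le> C * b powr (1 / q)" if "0 \<le> a" "0 \<le> b" "a \<le> B0 * b" "B0 \<le> B" for a b B0
  proof -
    have "a \<le> B * b" using that by (meson mult_right_mono order_trans)
    then have "a powr (1 / q) \<le> (B * b) powr (1 / q)" using that q by (intro powr_mono2) auto
    also have "\<dots> = C * b powr (1 / q)" using that by (simp add: C_def B_def powr_mult)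
    finally show ?thesis .
  qed
  have nn: "0 \<le> (\<Sum>\<^sub>\<infinity>i. cmod (c i) powr q * w i)" for c
    using w by (intro infsum_nonneg) auto
  show ?thesis
    unfolding lq_stable_def
  proof (intro exI[of _ C] conjI ballI allI C)
    fix c assume c: "c \<in> weighted_lq q w"
    show "(\<lambda>j. A i j * c j) summable_on UNIV" for i by (rule sm[OF c])
    show "mat_apply A c \<in> weighted_lq q w" by (rule mem[OF c])
    have "lq_norm q w c \<le> C * lq_norm q w (mat_apply A c)"
      unfolding lq_norm_def by (rule root[OF nn nn lower[OF c]]) (simp add: B_def)
    then show "inverse C * lq_norm q w c \<le> lq_norm q w (mat_apply A c)"
      using C by (simp add: field_simps)
    show "lq_norm q w (mat_apply A c) \<le> C * lq_norm q w c"
      unfolding lq_norm_def by (rule root[OF nn nn upper[OF c]]) (simp add: B_def)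
  qed
qed

text \<open>A trapezoid with Lipschitz constant 1/N, which is the source of the gain in the
  commutator.\<close>

definition cutoff :: "nat \<Rightarrow> int ^ 'd::finite \<Rightarrow> int ^ 'd \<Rightarrow> real" where
  "cutoff N n i = max 0 (min 1 (2 - real_of_int (maxnorm (i - n)) / real N))"

lemma cutoff_nonneg: "0 \<le> cutoff N n i" and cutoff_le_1: "cutoff N n i \<le> 1"
  by (simp_all add: cutoff_def)

lemma cutoff_eq_1: "i \<in> qbox N n \<Longrightarrow> 1 \<le> N \<Longrightarrow> cutoff N n i = 1"
  by (simp add: cutoff_def qbox_def min_def max_def field_simps)

lemma cutoff_eq_0: "i \<notin> qbox (2 * N) n \<Longrightarrow> 1 \<le> N \<Longrightarrow> cutoff N n i = 0"
  by (simp add: cutoff_def qbox_def min_def max_def field_simps)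

lemma cutoff_diff_le:
  assumes "1 \<le> N"
  shows "\<bar>cutoff N n j - cutoff N n i\<bar> \<le> min 1 (real_of_int (maxnorm (i - j)) / real N)"
proof -
  let ?a = "real_of_int (maxnorm (i - n)) / real N" and ?b = "real_of_int (maxnorm (j - n)) / real N"
  let ?t = "real_of_int (maxnorm (i - j)) / real N"
  have "maxnorm (i - n) \<le> maxnorm (i - j) + maxnorm (j - n)"
    "maxnorm (j - n) \<le> maxnorm (i - j) + maxnorm (i - n)"
    using maxnorm_diff_triangle[of i n j] maxnorm_diff_triangle[of j n i]
    by (simp_all add: maxnorm_diff_commute)
  then have "real_of_int (maxnorm (i - n)) \<le> real_of_int (maxnorm (i - j)) + real_of_int (maxnorm (j - n))"
    "real_of_int (maxnorm (j - n)) \<le> real_of_int (maxnorm (i - j)) + real_of_int (maxnorm (i - n))"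
    by linarith+
  then have "?a \<le> ?t + ?b" "?b \<le> ?t + ?a"
    using assms by (simp_all add: divide_right_mono flip: add_divide_distrib)
  then show ?thesis unfolding cutoff_def by linarith
qed

text \<open>Writing the cutoff at j as its value at i plus the difference separates the multiplied
  image from the commutator.\<close>

lemma mat_apply_cutoff_le:
  assumes sm: "(\<lambda>j. cmod (A i j) * cmod (c j)) summable_on UNIV"
  shows "(\<lambda>j. cmod (A i j) * \<bar>cutoff N n j - cutoff N n i\<bar> * cmod (c j)) summable_on UNIV"
    and "cmod (mat_apply A (\<lambda>j. of_real (cutoff N n j) * c j) i)
      \<le> cutoff N n i * cmod (mat_apply A c i)
         + (\<Sum>\<^sub>\<infinity>j. cmod (A i j) * \<bar>cutoff N n j - cutoff N n i\<bar> * cmod (c j))"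
proof -
  let ?\<psi> = "cutoff N n"
  let ?D = "\<lambda>j. A i j * of_real (?\<psi> j - ?\<psi> i) * c j"
  have normD: "cmod (?D j) = cmod (A i j) * \<bar>?\<psi> j - ?\<psi> i\<bar> * cmod (c j)" for j
    by (simp add: norm_mult del: of_real_diff)
  have "\<bar>?\<psi> j - ?\<psi> i\<bar> \<le> 1" for j
    using cutoff_nonneg[of N n j] cutoff_nonneg[of N n i] cutoff_le_1[of N n j] cutoff_le_1[of N n i]
    by linarith
  then have "cmod (?D j) \<le> cmod (A i j) * cmod (c j)" for j
    unfolding normD by (intro mult_right_mono mult_left_le) auto
  then have absD: "(\<lambda>j. cmod (?D j)) summable_on UNIV"
    by (intro summable_on_comparison_test[OF sm]) auto
  then show "(\<lambda>j. cmod (A i j) * \<bar>?\<psi> j - ?\<psi> i\<bar> * cmod (c j)) summable_on UNIV"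
    by (simp only: normD)
  have smc: "(\<lambda>j. A i j * c j) summable_on UNIV"
    by (rule abs_summable_summable) (use sm in \<open>simp add: norm_mult\<close>)
  have "mat_apply A (\<lambda>j. of_real (?\<psi> j) * c j) i = (\<Sum>\<^sub>\<infinity>j. of_real (?\<psi> i) * (A i j * c j) + ?D j)"
    unfolding mat_apply_def by (intro infsum_cong) (simp add: algebra_simps)
  also have "\<dots> = of_real (?\<psi> i) * mat_apply A c i + (\<Sum>\<^sub>\<infinity>j. ?D j)"
    unfolding mat_apply_def
    by (subst infsum_add) (auto intro!: summable_on_cmult_right smc abs_summable_summable[OF absD]
        simp: infsum_cmult_right' simp del: of_real_diff)
  also have "cmod \<dots> \<le> ?\<psi> i * cmod (mat_apply A c i) + (\<Sum>\<^sub>\<infinity>j. cmod (?D j))"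
    by (rule norm_triangle_mono)
      (use norm_infsum_bound[OF absD] in \<open>simp_all add: norm_mult cutoff_nonneg\<close>)
  finally show "cmod (mat_apply A (\<lambda>j. of_real (?\<psi> j) * c j) i)
      \<le> ?\<psi> i * cmod (mat_apply A c i) + (\<Sum>\<^sub>\<infinity>j. cmod (A i j) * \<bar>?\<psi> j - ?\<psi> i\<bar> * cmod (c j))"
    by (simp only: normD)
qed

text \<open>The bound holds at all distances from 2^(k-1) on, not only in a dyadic shell, so a scale
  below that of the actual distance may be used.\<close>

locale dyadic_majorant =
  fixes A :: "'d::finite lattice_matrix" and e :: "nat \<Rightarrow> real"
  assumes e_nonneg: "0 \<le> e k" and e_summable: "summable e"
    and cmod_le: "int (2 ^ k div 2) \<le> maxnorm (i - j) \<Longrightarrow> cmod (A i j) \<le> e k / side (2 ^ k) ^ CARD('d)"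
begin

definition damped :: "nat \<Rightarrow> nat \<Rightarrow> real" where
  "damped M k = e k * min 1 (2 ^ k / 2 ^ M)"

text \<open>For pairs at distance much larger than N = 2^M the cutoff gives no gain and smallness
  comes from the tail of \<open>e\<close>. In this range the factor in \<open>damped\<close> is 1,
  so one small quantity controls both.\<close>

definition tail :: "nat \<Rightarrow> nat \<Rightarrow> real" where
  "tail M k = (if M + 2 \<le> k then e k else 0)"

lemma damped_nonneg: "0 \<le> damped M k"
  by (simp add: damped_def e_nonneg)

lemma damped_summable: "summable (damped M)"
proof (rule summable_comparison_test'[OF e_summable])
  show "norm (damped M k) \<le> e k" for k
    using e_nonneg[of k] by (auto simp: damped_def abs_mult intro: mult_left_le)
qed

lemma tail_nonneg: "0 \<le> tail M k"
  by (simp add: tail_def e_nonneg)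

lemma tail_le_damped: "tail M k \<le> damped M k"
proof (cases "M + 2 \<le> k")
  case True
  then have "(2 :: real) ^ M \<le> 2 ^ k" by (intro power_increasing) auto
  then show ?thesis by (simp add: tail_def damped_def e_nonneg)
qed (simp add: tail_def damped_nonneg)

lemma tail_summable: "summable (tail M)"
  by (rule summable_comparison_test'[OF damped_summable[of M], of 0])
    (simp add: tail_nonneg tail_le_damped)

lemma suminf_tail_le: "suminf (tail M) \<le> suminf (damped M)"
  by (intro suminf_le tail_le_damped tail_summable damped_summable)

lemma ex_scale: "\<exists>k. int (2 ^ k div 2) \<le> maxnorm (i - j) \<and> j \<in> qbox (2 ^ k) i"
proof -
  obtain k where k: "2 ^ k div 2 \<le> nat (maxnorm (i - j))" "nat (maxnorm (i - j)) \<le> 2 ^ k"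
    using ex_dyadic_scale by blast
  have "int (2 ^ k div 2) \<le> maxnorm (i - j)" "maxnorm (i - j) \<le> int (2 ^ k)"
    using k maxnorm_nonneg[of "i - j"] by linarith+
  then show ?thesis by (auto simp: qbox_def maxnorm_diff_commute)
qed

lemma mat_apply_le_avg_series:
  assumes "summable (\<lambda>k. e k * avg (2 ^ k) (\<lambda>j. cmod (c j)) i)"
  shows "(\<lambda>j. cmod (A i j) * cmod (c j)) summable_on UNIV"
    and "(\<lambda>j. A i j * c j) summable_on UNIV"
    and "cmod (mat_apply A c i) \<le> (\<Sum>k. e k * avg (2 ^ k) (\<lambda>j. cmod (c j)) i)"
proof -
  have dom: "\<exists>k. j \<in> qbox (2 ^ k) i \<and> cmod (A i j) \<le> e k / side (2 ^ k) ^ CARD('d)" for j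
    using ex_scale[of i j] cmod_le by blast
  note ker = infsum_kernel_le_avg_series[where f = "\<lambda>j. cmod (c j)" and e = e and r = "\<lambda>k. 2 ^ k"
      and i = i and \<kappa> = "\<lambda>j. cmod (A i j)", OF norm_ge_zero e_nonneg assms norm_ge_zero dom]
  show 1: "(\<lambda>j. cmod (A i j) * cmod (c j)) summable_on UNIV" by (rule ker(1))
  then have 2: "(\<lambda>j. norm (A i j * c j)) summable_on UNIV" by (simp add: norm_mult)
  then show "(\<lambda>j. A i j * c j) summable_on UNIV" by (rule abs_summable_summable)
  have "cmod (mat_apply A c i) \<le> (\<Sum>\<^sub>\<infinity>j. norm (A i j * c j))"
    unfolding mat_apply_def by (rule norm_infsum_bound[OF 2])
  also have "\<dots> \<le> (\<Sum>k. e k * avg (2 ^ k) (\<lambda>j. cmod (c j)) i)"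
    using ker(2) by (simp add: norm_mult)
  finally show "cmod (mat_apply A c i) \<le> (\<Sum>k. e k * avg (2 ^ k) (\<lambda>j. cmod (c j)) i)" .
qed

text \<open>At scale k the Lipschitz bound of the cutoff multiplies \<open>e k\<close> by exactly
  the factor in \<open>damped\<close>.\<close>

lemma commutator_kernel_le_near:
  fixes f :: "int ^ 'd \<Rightarrow> real"
  assumes f: "\<And>j. 0 \<le> f j" and sm: "summable (\<lambda>k. damped M k * avg (2 ^ k) f i)"
  shows "(\<Sum>\<^sub>\<infinity>j. (cmod (A i j) * \<bar>cutoff (2 ^ M) n j - cutoff (2 ^ M) n i\<bar>) * f j)
           \<le> (\<Sum>k. damped M k * avg (2 ^ k) f i)"
proof (rule infsum_kernel_le_avg_series(2)[where r = "\<lambda>k. 2 ^ k", OF f damped_nonneg sm])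
  fix j
  obtain k where k: "int (2 ^ k div 2) \<le> maxnorm (i - j)" "j \<in> qbox (2 ^ k) i"
    using ex_scale by blast
  have "maxnorm (i - j) \<le> 2 ^ k" using k(2) by (simp add: qbox_def maxnorm_diff_commute)
  then have "real_of_int (maxnorm (i - j)) \<le> 2 ^ k"
    by (metis of_int_le_iff of_int_numeral of_int_power)
  then have "real_of_int (maxnorm (i - j)) / 2 ^ M \<le> 2 ^ k / 2 ^ M"
    by (intro divide_right_mono) auto
  then have "min 1 (real_of_int (maxnorm (i - j)) / real (2 ^ M)) \<le> min 1 (2 ^ k / 2 ^ M)"
    by (intro min.mono) auto
  then have "\<bar>cutoff (2 ^ M) n j - cutoff (2 ^ M) n i\<bar> \<le> min 1 (2 ^ k / 2 ^ M)"
    using cutoff_diff_le[of "2 ^ M" n j i] by (simp add: order_trans[rotated])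
  then have "cmod (A i j) * \<bar>cutoff (2 ^ M) n j - cutoff (2 ^ M) n i\<bar>
      \<le> e k / side (2 ^ k) ^ CARD('d) * min 1 (2 ^ k / 2 ^ M)"
    using e_nonneg by (intro mult_mono cmod_le k) auto
  then show "\<exists>k. j \<in> qbox (2 ^ k) i \<and>
      cmod (A i j) * \<bar>cutoff (2 ^ M) n j - cutoff (2 ^ M) n i\<bar> \<le> damped M k / side (2 ^ k) ^ CARD('d)"
    using k(2) by (auto simp: damped_def intro!: exI[of _ k])
qed simp

text \<open>The function lives outside radius 4N, where the cutoff vanishes, so only i within 2N of
  n contribute. For these, i - j is at least half the lower dyadic bound of n - j, so averages can
  be centred at n and the bound no longer depends on i.\<close>

lemma commutator_kernel_le_far:
  fixes f :: "int ^ 'd \<Rightarrow> real"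
  assumes f: "\<And>j. 0 \<le> f j" and sm: "summable (\<lambda>k. tail M k * avg (2 ^ Suc k) f n)"
    and zero: "\<And>j. j \<in> qbox (2 ^ (M + 2)) n \<Longrightarrow> f j = 0"
  shows "(\<Sum>\<^sub>\<infinity>j. (cmod (A i j) * \<bar>cutoff (2 ^ M) n j - cutoff (2 ^ M) n i\<bar>) * f j)
           \<le> (if i \<in> qbox (2 ^ Suc M) n then 2 ^ CARD('d) * (\<Sum>k. tail M k * avg (2 ^ Suc k) f n) else 0)"
proof -
  let ?\<kappa> = "\<lambda>j. cmod (A i j) * \<bar>cutoff (2 ^ M) n j - cutoff (2 ^ M) n i\<bar>"
  \<comment> \<open>Setting the kernel to 0 where f vanishes leaves the domination to be checked for
    far j only.\<close>
  let ?\<kappa>' = "\<lambda>j. if j \<in> qbox (2 ^ (M + 2)) n then 0 else ?\<kappa> j"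
  have eq: "(\<Sum>\<^sub>\<infinity>j. ?\<kappa> j * f j) = (\<Sum>\<^sub>\<infinity>j. ?\<kappa>' j * f j)"
    by (intro infsum_cong) (auto simp: zero)
  show ?thesis
  proof (cases "i \<in> qbox (2 ^ Suc M) n")
    case False
    have sub: "qbox (2 ^ Suc M) n \<subseteq> qbox (2 ^ (M + 2)) n" by (rule qbox_mono) simp
    have "?\<kappa>' j = 0" for j
      using False sub cutoff_eq_0[of i "2 ^ M" n] cutoff_eq_0[of j "2 ^ M" n] by auto
    then show ?thesis using False by (simp only: eq) simp
  next
    case True
    have sm': "summable (\<lambda>k. (2 ^ CARD('d) * tail M k) * avg (2 ^ Suc k) f n)"
      using summable_mult[OF sm, of "2 ^ CARD('d)"] by (simp add: mult.assoc)
    have "(\<Sum>\<^sub>\<infinity>j. ?\<kappa>' j * f j) \<le> (\<Sum>k. (2 ^ CARD('d) * tail M k) * avg (2 ^ Suc k) f n)"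
    proof (rule infsum_kernel_le_avg_series(2)[where r = "\<lambda>k. 2 ^ Suc k", OF f _ sm'])
      show "0 \<le> 2 ^ CARD('d) * tail M k" for k by (simp add: tail_nonneg)
      show "0 \<le> ?\<kappa>' j" for j by simp
      fix j assume "0 < ?\<kappa>' j"
      then have j: "j \<notin> qbox (2 ^ (M + 2)) n" by (auto split: if_splits)
      obtain l where l: "int (2 ^ l div 2) \<le> maxnorm (n - j)" "j \<in> qbox (2 ^ l) n"
        using ex_scale by blast
      \<comment> \<open>Since j is outside radius 2^(M+2), its scale l exceeds M + 2, and the
        lowered scale k = l - 1 still lies in the range of \<open>tail\<close>.\<close>
      have "M + 2 < l"
      proof (rule ccontr)
        assume "\<not> M + 2 < l"
        then have "qbox (2 ^ l) n \<subseteq> qbox (2 ^ (M + 2)) n" by (intro qbox_mono power_increasing) auto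
        then show False using l(2) j by blast
      qed
      then obtain k where k: "l = Suc k" "M + 2 \<le> k" by (cases l) auto
      have i: "maxnorm (i - n) \<le> 2 ^ Suc M" using True by (simp add: qbox_def)
      have "(2 :: int) ^ (M + 2) \<le> 2 ^ k" using k by (intro power_increasing) auto
      moreover have "(2 :: int) ^ k \<le> maxnorm (n - j)" using l(1) k(1) by simp
      moreover have "maxnorm (n - j) \<le> maxnorm (i - n) + maxnorm (i - j)"
        using maxnorm_diff_triangle[of n j i] by (simp add: maxnorm_diff_commute)
      moreover have "int (2 ^ k div 2) * 2 = 2 ^ k"
        using k by (cases k) auto
      ultimately have "int (2 ^ k div 2) \<le> maxnorm (i - j)" using i by simp
      then have A: "cmod (A i j) \<le> e k / side (2 ^ k) ^ CARD('d)" by (rule cmod_le)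
      have "\<bar>cutoff (2 ^ M) n j - cutoff (2 ^ M) n i\<bar> \<le> 1"
        using cutoff_diff_le[of "2 ^ M" n j i] by simp
      then have "?\<kappa>' j \<le> cmod (A i j)" by (auto intro: mult_left_le)
      also note A
      also have "e k / side (2 ^ k) ^ CARD('d) \<le> (2 ^ CARD('d) * e k) / side (2 ^ Suc k) ^ CARD('d)"
      proof -
        have "side (2 ^ Suc k) ^ CARD('d) \<le> (2 * side (2 ^ k)) ^ CARD('d)"
          using side_mult_le[of 2 "2 ^ k"] by (intro power_mono) auto
        then have "e k * side (2 ^ Suc k) ^ CARD('d) \<le> e k * (2 * side (2 ^ k)) ^ CARD('d)"
          by (intro mult_left_mono e_nonneg)
        then show ?thesis
          by (simp add: divide_le_eq pos_le_divide_eq power_mult_distrib mult_ac)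
      qed
      also have "\<dots> = (2 ^ CARD('d) * tail M k) / side (2 ^ Suc k) ^ CARD('d)"
        using k(2) by (simp add: tail_def)
      finally show "\<exists>k. j \<in> qbox (2 ^ Suc k) n \<and> ?\<kappa>' j \<le> (2 ^ CARD('d) * tail M k) / side (2 ^ Suc k) ^ CARD('d)"
        using l(2) k(1) by blast
    qed
    also have "\<dots> = 2 ^ CARD('d) * (\<Sum>k. tail M k * avg (2 ^ Suc k) f n)"
      by (subst suminf_mult[OF sm, symmetric]) (simp add: mult.assoc)
    finally show ?thesis using True by (simp only: eq) simp
  qed
qed

end

subsection \<open>Transfer of stability\<close>

locale stable_matrix = aq_weight q w K + dyadic_majorant A e
  for q :: real and w :: "int ^ 'd::finite \<Rightarrow> real" and K :: real
    and A :: "'d lattice_matrix" and e :: "nat \<Rightarrow> real" +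
  fixes C :: real
  assumes C_pos: "0 < C"
    and stable: "u \<in> weighted_lq q w \<Longrightarrow>
      (\<lambda>i. cmod (mat_apply A u i) powr q * w i) summable_on UNIV \<and>
      (\<Sum>\<^sub>\<infinity>i. cmod (u i) powr q * w i) \<le> C * (\<Sum>\<^sub>\<infinity>i. cmod (mat_apply A u i) powr q * w i)"
begin

text \<open>Here c need not belong to the source space: stability is applied to the cutoff times c,
  which has finite support. The three terms are the image of c, the near commutator (spread over the
  lattice, hence bounded by series of averages) and the far commutator (a constant on the
  2N-ball).\<close>

lemma sum_powr_qbox_le:
  fixes c :: "int ^ 'd \<Rightarrow> complex" and n :: "int ^ 'd"
  defines "f \<equiv> \<lambda>j. cmod (c j)" and "g \<equiv> \<lambda>i. cmod (mat_apply A c i)"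
  assumes sm: "\<And>i. (\<lambda>j. cmod (A i j) * f j) summable_on UNIV"
    and smT: "summable (\<lambda>k. tail M k * avg (2 ^ Suc k) f n)"
  shows "(\<Sum>i\<in>qbox (2 ^ M) n. f i powr q * w i)
    \<le> C * 3 powr q * ((\<Sum>i\<in>qbox (2 ^ Suc M) n. g i powr q * w i)
        + avg_const * suminf (damped M) powr q * (\<Sum>i\<in>qbox (2 ^ (M + 2)) n. f i powr q * w i)
        + (2 ^ CARD('d) * (\<Sum>k. tail M k * avg (2 ^ Suc k) f n)) powr q * sum w (qbox (2 ^ Suc M) n))"
    (is "?L \<le> C * 3 powr q * (?a + ?b + ?c)")
proof -
  let ?\<psi> = "cutoff (2 ^ M) n"
  let ?Q = "qbox (2 ^ Suc M) n" and ?Q4 = "qbox (2 ^ (M + 2)) n"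
  define T where "T = 2 ^ CARD('d) * (\<Sum>k. tail M k * avg (2 ^ Suc k) f n)"
  define u where "u j = of_real (?\<psi> j) * c j" for j
  \<comment> \<open>Splitting at radius 4N: \<open>f1\<close> has finite support, so the
    source-space bound applies to it, and \<open>f2\<close> satisfies the vanishing condition of the
    far estimate.\<close>
  define f1 where "f1 j = (if j \<in> ?Q4 then f j else 0)" for j
  define f2 where "f2 j = (if j \<in> ?Q4 then 0 else f j)" for j
  define near where "near i = (\<Sum>k. damped M k * avg (2 ^ k) f1 i)" for i
  define S where "S = (\<Sum>i\<in>?Q4. f i powr q * w i)"
  have f: "0 \<le> f j" "0 \<le> f1 j" "0 \<le> f2 j" "f2 j \<le> f j" for j
    by (simp_all add: f_def f1_def f2_def)
  have T: "0 \<le> T" unfolding T_def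
    by (intro mult_nonneg_nonneg suminf_nonneg smT tail_nonneg avg_nonneg f) simp
  have cmod_u: "cmod (u j) = ?\<psi> j * f j" for j
    by (simp add: u_def f_def norm_mult cutoff_nonneg)
  have u_out: "u j = 0" if "j \<notin> ?Q" for j
    using that cutoff_eq_0[of j "2 ^ M" n] by (simp add: u_def)
  have u_mem: "u \<in> weighted_lq q w"
    unfolding weighted_lq_def
  proof (intro CollectI finite_nonzero_values_imp_summable_on)
    show "finite {i \<in> UNIV. cmod (u i) powr q * w i \<noteq> 0}"
      by (rule finite_subset[of _ ?Q]) (use u_out in fastforce)+
  qed
  have f1: "((\<lambda>i. f1 i powr q * w i) has_sum S) UNIV"
  proof -
    have "((\<lambda>i. f1 i powr q * w i) has_sum S) ?Q4"
      unfolding S_def f1_def by (intro has_sum_finiteI sum.cong) auto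
    then show ?thesis
      by (rule has_sum_cong_neutral[THEN iffD1, rotated -1]) (auto simp: f1_def)
  qed
  have smf1: "(\<lambda>i. f1 i powr q * w i) summable_on UNIV" and S: "(\<Sum>\<^sub>\<infinity>i. f1 i powr q * w i) = S"
    using f1 by (auto simp: has_sum_iff)
  have sm_near: "summable (\<lambda>k. damped M k * avg (2 ^ k) f1 i)" for i
    by (rule avg_series_summable[OF f(2) smf1 damped_nonneg damped_summable])
  have near0: "0 \<le> near i" for i
    unfolding near_def by (intro suminf_nonneg sm_near mult_nonneg_nonneg damped_nonneg avg_nonneg f)
  have bound: "cmod (mat_apply A u i) \<le> (if i \<in> ?Q then g i else 0) + near i + (if i \<in> ?Q then T else 0)"
    for i
  proof -
    let ?\<kappa> = "\<lambda>j. cmod (A i j) * \<bar>?\<psi> j - ?\<psi> i\<bar>"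
    have sm_i: "(\<lambda>j. cmod (A i j) * cmod (c j)) summable_on UNIV" using sm[of i] by (simp add: f_def)
    note le = mat_apply_cutoff_le[where A = A and c = c and i = i and N = "2 ^ M" and n = n, OF sm_i]
    have smk: "(\<lambda>j. ?\<kappa> j * f j) summable_on UNIV" using le(1) by (simp add: f_def)
    have smk1: "(\<lambda>j. ?\<kappa> j * f1 j) summable_on UNIV" and smk2: "(\<lambda>j. ?\<kappa> j * f2 j) summable_on UNIV"
      by (intro summable_on_comparison_test[OF smk]; simp add: f1_def f2_def f)+
    have "(\<Sum>\<^sub>\<infinity>j. ?\<kappa> j * f j) = (\<Sum>\<^sub>\<infinity>j. ?\<kappa> j * f1 j + ?\<kappa> j * f2 j)"
      by (intro infsum_cong) (auto simp: f1_def f2_def)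
    also have "\<dots> = (\<Sum>\<^sub>\<infinity>j. ?\<kappa> j * f1 j) + (\<Sum>\<^sub>\<infinity>j. ?\<kappa> j * f2 j)"
      by (rule infsum_add[OF smk1 smk2])
    also have "(\<Sum>\<^sub>\<infinity>j. ?\<kappa> j * f1 j) \<le> near i"
      unfolding near_def by (rule commutator_kernel_le_near[OF f(2) sm_near])
    also have "(\<Sum>\<^sub>\<infinity>j. ?\<kappa> j * f2 j) \<le> (if i \<in> ?Q then T else 0)"
    proof -
      have avg_le: "avg r f2 n \<le> avg r f n" for r
        unfolding avg_def by (intro divide_right_mono sum_mono f) simp
      have sm2: "summable (\<lambda>k. tail M k * avg (2 ^ Suc k) f2 n)"
        by (rule summable_comparison_test'[OF smT, of 0])
          (simp add: tail_nonneg avg_nonneg f mult_left_mono avg_le)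
      have "(\<Sum>k. tail M k * avg (2 ^ Suc k) f2 n) \<le> (\<Sum>k. tail M k * avg (2 ^ Suc k) f n)"
        by (intro suminf_le sm2 smT mult_left_mono avg_le tail_nonneg)
      then have "2 ^ CARD('d) * (\<Sum>k. tail M k * avg (2 ^ Suc k) f2 n) \<le> T"
        by (simp add: T_def)
      then show ?thesis
        using commutator_kernel_le_far[OF f(3) sm2, of i] by (auto simp: f2_def)
    qed
    finally have "(\<Sum>\<^sub>\<infinity>j. ?\<kappa> j * f j) \<le> near i + (if i \<in> ?Q then T else 0)" by simp
    moreover have "?\<psi> i * g i \<le> (if i \<in> ?Q then g i else 0)"
      using cutoff_eq_0[of i "2 ^ M" n] cutoff_le_1[of "2 ^ M" n i]
      by (auto simp: g_def mult_left_le_one_le cutoff_nonneg)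
    ultimately show ?thesis
      using le(2) unfolding u_def f_def g_def by linarith
  qed
  have "(\<Sum>i\<in>I. cmod (mat_apply A u i) powr q * w i) \<le> 3 powr q * (?a + ?b + ?c)" if I: "finite I" for I
  proof -
    let ?x = "\<lambda>i. if i \<in> ?Q then g i else 0" and ?y = "\<lambda>i. if i \<in> ?Q then T else 0"
    have g0: "0 \<le> g i" for i by (simp add: g_def)
    have "(\<Sum>i\<in>I. cmod (mat_apply A u i) powr q * w i)
        \<le> (\<Sum>i\<in>I. 3 powr q * (?x i powr q + near i powr q + ?y i powr q) * w i)"
    proof (intro sum_mono mult_right_mono w_nonneg)
      fix i
      have "cmod (mat_apply A u i) powr q \<le> (?x i + near i + ?y i) powr q"
        using q_ge_1 by (intro powr_mono2 bound) auto
      also have "\<dots> \<le> 3 powr q * (?x i powr q + near i powr q + ?y i powr q)"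
        using g0 T near0 q_ge_1 by (intro powr_add3_le) auto
      finally show "cmod (mat_apply A u i) powr q \<le> 3 powr q * (?x i powr q + near i powr q + ?y i powr q)" .
    qed
    also have "\<dots> = 3 powr q * ((\<Sum>i\<in>I. ?x i powr q * w i) + (\<Sum>i\<in>I. near i powr q * w i) + (\<Sum>i\<in>I. ?y i powr q * w i))"
      by (simp only: sum_distrib_left mult.assoc distrib_left distrib_right sum.distrib)
    also have "\<dots> \<le> 3 powr q * (?a + ?b + ?c)"
    proof (intro mult_left_mono add_mono)
      have "(\<Sum>i\<in>I. ?x i powr q * w i) = (\<Sum>i\<in>I \<inter> ?Q. g i powr q * w i)"
        by (simp add: sum.inter_restrict[OF I]) (rule sum.cong, auto)
      also have "\<dots> \<le> ?a" by (intro sum_mono2) auto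
      finally show "(\<Sum>i\<in>I. ?x i powr q * w i) \<le> ?a" .
      have "(\<Sum>i\<in>I. ?y i powr q * w i) = (\<Sum>i\<in>I \<inter> ?Q. T powr q * w i)"
        by (simp add: sum.inter_restrict[OF I]) (rule sum.cong, auto)
      also have "\<dots> \<le> (\<Sum>i\<in>?Q. T powr q * w i)" by (intro sum_mono2) auto
      also have "\<dots> = ?c" by (simp add: T_def sum_distrib_left)
      finally show "(\<Sum>i\<in>I. ?y i powr q * w i) \<le> ?c" .
      show "(\<Sum>i\<in>I. near i powr q * w i) \<le> ?b"
        using sum_avg_series_powr_le[OF f(2) smf1 damped_nonneg damped_summable I, where r = "\<lambda>k. 2 ^ k"]
        by (simp add: near_def S S_def)
    qed simp
    finally show ?thesis .
  qed
  note Au = this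
  have "?L \<le> (\<Sum>\<^sub>\<infinity>i. cmod (u i) powr q * w i)"
  proof -
    have "?L = (\<Sum>i\<in>qbox (2 ^ M) n. cmod (u i) powr q * w i)"
      by (intro sum.cong) (simp_all add: cmod_u cutoff_eq_1)
    also have "\<dots> \<le> (\<Sum>\<^sub>\<infinity>i. cmod (u i) powr q * w i)"
      using u_mem by (intro finite_sum_le_infsum_UNIV) (auto simp: weighted_lq_def)
    finally show ?thesis .
  qed
  also have "\<dots> \<le> C * (\<Sum>\<^sub>\<infinity>i. cmod (mat_apply A u i) powr q * w i)"
    using stable[OF u_mem] by blast
  also have "\<dots> \<le> C * (3 powr q * (?a + ?b + ?c))"
    using stable[OF u_mem] Au C_pos by (intro mult_left_mono infsum_le_finite_sums) auto
  finally show ?thesis by (simp only: mult.assoc)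
qed

text \<open>Independent of M and of the target exponent and weight, so M can be chosen after
  it.\<close>

definition local_const :: real where
  "local_const = (3 * (C * 3 powr q * (K * (2 ^ CARD('d)) powr q + avg_const * cover_const
      + K * (2 ^ CARD('d)) powr q * (4 ^ CARD('d) * K powr (1 / q)) powr q))) powr (1 / q)"

lemma local_const_nonneg: "0 \<le> local_const"
  by (simp add: local_const_def)

text \<open>Each term of \<open>sum_powr_qbox_le\<close> becomes the q-th power of an ordinary
  average times the same total weight. Cancelling that weight and taking q-th roots removes the
  source exponent and weight from the right-hand side, except through \<open>m\<close> and
  constants.\<close>

lemma local_mean_le:
  fixes c :: "int ^ 'd \<Rightarrow> complex" and n :: "int ^ 'd" and M :: nat
  defines "f \<equiv> \<lambda>j. cmod (c j)" and "g \<equiv> \<lambda>i. cmod (mat_apply A c i)"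
  defines "m \<equiv> local_mean (2 ^ M) f"
  assumes sm: "\<And>i. (\<lambda>j. cmod (A i j) * f j) summable_on UNIV"
    and sm': "summable (\<lambda>k. tail M k * avg (2 * 2 ^ Suc k) m n)"
  shows "m n \<le> local_const * (side (2 ^ Suc M) ^ CARD('d) * avg (2 ^ Suc M) g n
      + suminf (damped M) * avg (8 * 2 ^ M) m n + (\<Sum>k. tail M k * avg (2 * 2 ^ Suc k) m n))"
    (is "_ \<le> local_const * (?x + ?y + ?z)")
proof -
  let ?W = "sum w (qbox (2 ^ M) n)" and ?W2 = "sum w (qbox (2 ^ Suc M) n)"
  define K2 where "K2 = K * (2 ^ CARD('d)) powr q"
  define c4 where "c4 = 4 ^ CARD('d) * K powr (1 / q)"
  define T where "T = 2 ^ CARD('d) * (\<Sum>k. tail M k * avg (2 ^ Suc k) f n)"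
  have f: "0 \<le> f j" and g: "0 \<le> g j" and m: "0 \<le> m j" for j
    by (simp_all add: f_def g_def m_def)
  have K2: "0 \<le> K2" using K_pos by (simp add: K2_def)
  have c4: "0 \<le> c4" by (simp add: c4_def)
  have \<delta>: "0 \<le> suminf (damped M)" by (intro suminf_nonneg damped_nonneg damped_summable)
  have cover: "0 \<le> cover_const" using K_pos by (simp add: cover_const_def)
  have x: "0 \<le> ?x" by (intro mult_nonneg_nonneg avg_nonneg g) simp
  have y: "0 \<le> ?y" by (intro mult_nonneg_nonneg avg_nonneg m \<delta>)
  have z: "0 \<le> ?z" by (intro suminf_nonneg sm' mult_nonneg_nonneg tail_nonneg avg_nonneg m)
  have tail_le: "tail M k * avg (2 ^ Suc k) f n
      \<le> 2 ^ CARD('d) * K powr (1 / q) * (tail M k * avg (2 * 2 ^ Suc k) m n)" for k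
  proof (cases "M + 2 \<le> k")
    case True
    then have "(2 :: nat) ^ M \<le> 2 ^ Suc k" by (intro power_increasing) auto
    then have "avg (2 ^ Suc k) f n \<le> 2 ^ CARD('d) * K powr (1 / q) * avg (2 * 2 ^ Suc k) m n"
      unfolding m_def by (intro avg_le_avg_local_mean f)
    then have "tail M k * avg (2 ^ Suc k) f n
      \<le> tail M k * (2 ^ CARD('d) * K powr (1 / q) * avg (2 * 2 ^ Suc k) m n)"
      by (intro mult_left_mono tail_nonneg)
    then show ?thesis by (simp only: mult_ac)
  qed (simp add: tail_def)
  have sm'': "summable (\<lambda>k. 2 ^ CARD('d) * K powr (1 / q) * (tail M k * avg (2 * 2 ^ Suc k) m n))"
    by (intro summable_mult sm')
  have smT: "summable (\<lambda>k. tail M k * avg (2 ^ Suc k) f n)"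
  proof (rule summable_comparison_test'[OF sm'', of 0])
    show "norm (tail M k * avg (2 ^ Suc k) f n)
      \<le> 2 ^ CARD('d) * K powr (1 / q) * (tail M k * avg (2 * 2 ^ Suc k) m n)" for k
      using tail_le[of k] by (simp add: tail_nonneg avg_nonneg f)
  qed
  have T0: "0 \<le> T" unfolding T_def
    by (intro mult_nonneg_nonneg suminf_nonneg smT tail_nonneg avg_nonneg f) simp
  have "(\<Sum>k. tail M k * avg (2 ^ Suc k) f n)
      \<le> (\<Sum>k. 2 ^ CARD('d) * K powr (1 / q) * (tail M k * avg (2 * 2 ^ Suc k) m n))"
    by (rule suminf_le[OF tail_le smT sm''])
  also have "\<dots> = 2 ^ CARD('d) * K powr (1 / q) * ?z" by (rule suminf_mult[OF sm'])
  finally have "T \<le> 2 ^ CARD('d) * (2 ^ CARD('d) * K powr (1 / q) * ?z)"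
    by (simp add: T_def)
  also have "\<dots> = c4 * ?z" by (simp add: c4_def power_mult_distrib[symmetric] mult.assoc[symmetric])
  finally have Tz: "T \<le> c4 * ?z" .
  \<comment> \<open>Doubling brings the weight of the 2N-ball back to that of the N-ball, so that it
    can be cancelled.\<close>
  have W2: "?W2 \<le> K2 * ?W"
    unfolding K2_def using side_mult_le[of 2 "2 ^ M"] by (intro sum_w_qbox_le) auto
  have W: "0 < ?W" by simp
  have 1: "(\<Sum>i\<in>qbox (2 ^ Suc M) n. g i powr q * w i) \<le> K2 * ?x powr q * ?W"
  proof -
    have "(\<Sum>i\<in>qbox (2 ^ Suc M) n. g i powr q * w i) \<le> ?x powr q * ?W2"
      using sum_powr_le_powr_sum[of g, OF g] by (simp only: sum_qbox_eq_avg[symmetric])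
    also have "\<dots> \<le> ?x powr q * (K2 * ?W)" by (intro mult_left_mono W2) simp
    finally show ?thesis by (simp only: mult_ac)
  qed
  have 2: "avg_const * suminf (damped M) powr q * (\<Sum>i\<in>qbox (2 ^ (M + 2)) n. f i powr q * w i)
      \<le> avg_const * cover_const * ?y powr q * ?W"
  proof -
    have "(\<Sum>i\<in>qbox (4 * 2 ^ M) n. f i powr q * w i) \<le> cover_const * avg (8 * 2 ^ M) m n powr q * ?W"
      unfolding m_def by (rule sum_powr_le_avg_local_mean[OF f]) simp
    then have "avg_const * suminf (damped M) powr q * (\<Sum>i\<in>qbox (4 * 2 ^ M) n. f i powr q * w i)
        \<le> avg_const * suminf (damped M) powr q * (cover_const * avg (8 * 2 ^ M) m n powr q * ?W)"
      using avg_const_pos by (intro mult_left_mono) auto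
    also have "\<dots> = avg_const * cover_const * ?y powr q * ?W"
      using \<delta> m by (simp add: powr_mult avg_nonneg mult_ac)
    finally show ?thesis by (simp add: power_add mult.commute)
  qed
  have 3: "T powr q * ?W2 \<le> K2 * c4 powr q * ?z powr q * ?W"
  proof -
    have "T powr q * ?W2 \<le> (c4 * ?z) powr q * (K2 * ?W)"
      using q_ge_1 T0 Tz W2 by (intro mult_mono powr_mono2) (auto intro: sum_nonneg)
    also have "\<dots> = K2 * c4 powr q * ?z powr q * ?W"
      using c4 z by (simp add: powr_mult)
    finally show ?thesis .
  qed
  \<comment> \<open>Dominating each power by that of the whole sum allows a single q-th root to be
    taken.\<close>
  let ?s = "(?x + ?y + ?z) powr q"
  have le: "?x powr q \<le> ?s" "?y powr q \<le> ?s" "?z powr q \<le> ?s"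
    using x y z q_ge_1 by (auto intro!: powr_mono2)
  have s0: "0 \<le> ?s" by simp
  have "m n powr q * ?W = (\<Sum>i\<in>qbox (2 ^ M) n. f i powr q * w i)"
    unfolding m_def by (rule local_mean_powr)
  also have "\<dots> \<le> C * 3 powr q * ((\<Sum>i\<in>qbox (2 ^ Suc M) n. g i powr q * w i)
        + avg_const * suminf (damped M) powr q * (\<Sum>i\<in>qbox (2 ^ (M + 2)) n. f i powr q * w i)
        + T powr q * ?W2)"
    unfolding T_def f_def g_def by (rule sum_powr_qbox_le) (use sm smT in \<open>simp_all only: f_def\<close>)
  also have "\<dots> \<le> C * 3 powr q * (K2 * ?x powr q * ?W + avg_const * cover_const * ?y powr q * ?W
        + K2 * c4 powr q * ?z powr q * ?W)"
    using C_pos by (intro mult_left_mono add_mono 1 2 3) auto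
  also have "\<dots> \<le> C * 3 powr q * (K2 * ?s * ?W + avg_const * cover_const * ?s * ?W
        + K2 * c4 powr q * ?s * ?W)"
    using C_pos K2 W avg_const_pos cover
    by (intro mult_left_mono add_mono mult_right_mono le) (auto intro: less_imp_le)
  also have "\<dots> = (C * 3 powr q * (K2 + avg_const * cover_const + K2 * c4 powr q)) * ?s * ?W"
    by (simp add: algebra_simps)
  also have "\<dots> \<le> (3 * (C * 3 powr q * (K2 + avg_const * cover_const + K2 * c4 powr q))) * ?s * ?W"
    using C_pos K2 W avg_const_pos cover by (intro mult_right_mono) (auto intro: less_imp_le)
  finally have "m n \<le> (3 * (C * 3 powr q * (K2 + avg_const * cover_const + K2 * c4 powr q))) powr (1 / q)
      * (?x + ?y + ?z)"
    using C_pos K2 avg_const_pos cover x y z m by (intro le_of_weighted_powr_le[OF _ W]) auto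
  then show ?thesis by (simp only: local_const_def K2_def c4_def)
qed

lemma stable_transfer:
  assumes "aq_weight q' w' K'"
  shows "lq_stable q' w' A"
proof -
  interpret V: aq_weight q' w' K' by fact
  let ?D = "V.avg_const"
  let ?L = "local_const"
  have D: "0 < ?D" by (rule V.avg_const_pos)
  have q': "0 < q'" "0 \<le> q'" using V.q_ge_1 by simp_all
  define a where "a = (3 * ?L) powr q' * ?D"
  have a: "0 \<le> a" using D by (simp add: a_def)
  \<comment> \<open>Two terms, \<open>?y\<close> and \<open>?z\<close>, will carry the small mass,
    whence the factor 2. As \<open>a\<close> does not depend on M, a suitable M makes their total
    coefficient less than 1/2.\<close>
  have "(\<lambda>M. 2 * a * suminf (damped M) powr q') \<longlonglongrightarrow> 2 * a * 0 powr q'"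
  proof (intro tendsto_intros tendsto_powr')
    show "(\<lambda>M. suminf (damped M)) \<longlonglongrightarrow> 0"
      using tendsto_damped_suminf[OF e_nonneg e_summable] by (simp add: damped_def[abs_def])
    show "0 \<noteq> (0::real) \<or> 0 < q' \<and> (\<forall>\<^sub>F M in sequentially. 0 \<le> suminf (damped M))"
      using q' by (auto intro!: always_eventually suminf_nonneg damped_nonneg damped_summable)
  qed
  then have "\<forall>\<^sub>F M in sequentially. 2 * a * suminf (damped M) powr q' < 1 / 2"
    by (rule order_tendstoD) simp
  then obtain M where M: "2 * a * suminf (damped M) powr q' < 1 / 2"
    by (auto simp: eventually_sequentially)
  define \<delta> where "\<delta> = suminf (damped M)"
  have \<delta>: "0 \<le> \<delta>" unfolding \<delta>_def by (intro suminf_nonneg damped_nonneg damped_summable)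
  let ?N = "2 ^ M :: nat"
  define s where "s = side (2 ^ Suc M) ^ CARD('d)"
  define b where "b = (side ?N ^ CARD('d) * K powr (1 / q)) powr q'"
  define B1 where "B1 = b * (2 * a * s powr q')"
  define B2 where "B2 = ?D * suminf e powr q'"
  have s: "0 \<le> s" by (simp add: s_def)
  \<comment> \<open>Boundedness on the target space uses only the dyadic majorant and averaging
    there, not stability.\<close>
  have upper: "(\<forall>i. (\<lambda>j. cmod (A i j) * cmod (c j)) summable_on UNIV) \<and>
      (\<forall>i. (\<lambda>j. A i j * c j) summable_on UNIV) \<and>
      (\<lambda>i. cmod (mat_apply A c i) powr q' * w' i) summable_on UNIV \<and>
      (\<Sum>\<^sub>\<infinity>i. cmod (mat_apply A c i) powr q' * w' i) \<le> B2 * (\<Sum>\<^sub>\<infinity>i. cmod (c i) powr q' * w' i)"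
    if c: "c \<in> weighted_lq q' w'" for c
  proof -
    have smc: "(\<lambda>i. cmod (c i) powr q' * w' i) summable_on UNIV" using c by (simp add: weighted_lq_def)
    have ser: "summable (\<lambda>k. e k * avg (2 ^ k) (\<lambda>j. cmod (c j)) i)" for i
      by (rule V.avg_series_summable[OF norm_ge_zero smc e_nonneg e_summable])
    note le = mat_apply_le_avg_series[OF ser]
    have fin: "(\<Sum>i\<in>I. cmod (mat_apply A c i) powr q' * w' i) \<le> B2 * (\<Sum>\<^sub>\<infinity>i. cmod (c i) powr q' * w' i)"
      if "finite I" for I
    proof -
      have "(\<Sum>i\<in>I. cmod (mat_apply A c i) powr q' * w' i)
          \<le> (\<Sum>i\<in>I. (\<Sum>k. e k * avg (2 ^ k) (\<lambda>j. cmod (c j)) i) powr q' * w' i)"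
        using le(3) q' by (intro sum_mono mult_right_mono powr_mono2 V.w_nonneg) auto
      also have "\<dots> \<le> B2 * (\<Sum>\<^sub>\<infinity>i. cmod (c i) powr q' * w' i)"
        unfolding B2_def by (rule V.sum_avg_series_powr_le[OF norm_ge_zero smc e_nonneg e_summable that])
      finally show ?thesis .
    qed
    have "(\<lambda>i. cmod (mat_apply A c i) powr q' * w' i) summable_on UNIV"
      by (rule summable_on_and_infsum_le(1)[OF _ fin]) simp_all
    moreover have "(\<Sum>\<^sub>\<infinity>i. cmod (mat_apply A c i) powr q' * w' i) \<le> B2 * (\<Sum>\<^sub>\<infinity>i. cmod (c i) powr q' * w' i)"
      by (rule summable_on_and_infsum_le(2)[OF _ fin]) simp_all
    ultimately show ?thesis using le by blast
  qed
  have lower: "(\<Sum>\<^sub>\<infinity>i. cmod (c i) powr q' * w' i) \<le> B1 * (\<Sum>\<^sub>\<infinity>i. cmod (mat_apply A c i) powr q' * w' i)"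
    if c: "c \<in> weighted_lq q' w'" for c
  proof -
    define f where "f j = cmod (c j)" for j
    define g where "g i = cmod (mat_apply A c i)" for i
    define m where "m = local_mean ?N f"
    define F where "F = (\<Sum>\<^sub>\<infinity>i. f i powr q' * w' i)"
    define G where "G = (\<Sum>\<^sub>\<infinity>i. g i powr q' * w' i)"
    define S where "S = (\<Sum>\<^sub>\<infinity>i. m i powr q' * w' i)"
    have f: "0 \<le> f j" and g: "0 \<le> g j" and m: "0 \<le> m j" for j
      by (simp_all add: f_def g_def m_def)
    have smf: "(\<lambda>i. f i powr q' * w' i) summable_on UNIV"
      using c by (simp add: weighted_lq_def f_def)
    have smg: "(\<lambda>i. g i powr q' * w' i) summable_on UNIV"
      and smA: "(\<lambda>j. cmod (A i j) * cmod (c j)) summable_on UNIV" for i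
      using upper[OF c] by (simp_all add: g_def)
    \<comment> \<open>Finiteness of S, with a constant depending on N; it is what permits
      subtracting S/2 below.\<close>
    have smm: "(\<lambda>i. m i powr q' * w' i) summable_on UNIV"
      by (rule V.summable_powr_of_le_avg[OF f smf m, where r = ?N and a = "side ?N ^ CARD('d)"])
        (simp_all add: m_def local_mean_le_avg f)
    have S0: "0 \<le> S" unfolding S_def by (intro infsum_nonneg) simp
    let ?r = "\<lambda>k. 2 * 2 ^ Suc k"
    let ?x = "\<lambda>i. s * avg (2 ^ Suc M) g i" and ?y = "\<lambda>i. \<delta> * avg (8 * ?N) m i"
      and ?z = "\<lambda>i. \<Sum>k. tail M k * avg (?r k) m i"
    have smz: "summable (\<lambda>k. tail M k * avg (?r k) m i)" for i
      by (rule V.avg_series_summable[OF m smm tail_nonneg tail_summable])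
    have m_le: "m i \<le> ?L * (?x i + ?y i + ?z i)" for i
      using local_mean_le[of c M i] smA smz by (simp add: m_def f_def[abs_def] g_def[abs_def] s_def \<delta>_def)
    have xyz: "0 \<le> ?x i" "0 \<le> ?y i" "0 \<le> ?z i" for i
      by (intro mult_nonneg_nonneg s \<delta> avg_nonneg g m suminf_nonneg smz tail_nonneg)+
    have "(\<Sum>i\<in>I. m i powr q' * w' i) \<le> a * s powr q' * G + 1 / 2 * S" if I: "finite I" for I
    proof -
      have "(\<Sum>i\<in>I. m i powr q' * w' i)
          \<le> (\<Sum>i\<in>I. (3 * ?L) powr q' * (?x i powr q' + ?y i powr q' + ?z i powr q') * w' i)"
      proof (intro sum_mono mult_right_mono V.w_nonneg)
        fix i
        have "m i powr q' \<le> (?L * (?x i + ?y i + ?z i)) powr q'"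
          using q' by (intro powr_mono2 m_le m)
        also have "\<dots> = ?L powr q' * (?x i + ?y i + ?z i) powr q'"
          using local_const_nonneg xyz[of i] by (simp add: powr_mult)
        also have "\<dots> \<le> ?L powr q' * (3 powr q' * (?x i powr q' + ?y i powr q' + ?z i powr q'))"
          using xyz[of i] q' by (intro mult_left_mono powr_add3_le) auto
        also have "\<dots> = (3 * ?L) powr q' * (?x i powr q' + ?y i powr q' + ?z i powr q')"
          using local_const_nonneg by (simp add: powr_mult)
        finally show "m i powr q' \<le> (3 * ?L) powr q' * (?x i powr q' + ?y i powr q' + ?z i powr q')" .
      qed
      also have "\<dots> = (3 * ?L) powr q' * ((\<Sum>i\<in>I. ?x i powr q' * w' i)
          + (\<Sum>i\<in>I. ?y i powr q' * w' i) + (\<Sum>i\<in>I. ?z i powr q' * w' i))"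
        by (simp only: sum_distrib_left mult.assoc distrib_left distrib_right sum.distrib)
      also have "\<dots> \<le> (3 * ?L) powr q' * (?D * s powr q' * G + ?D * \<delta> powr q' * S + ?D * \<delta> powr q' * S)"
      proof (intro mult_left_mono add_mono)
        have "(\<Sum>i\<in>I. ?x i powr q' * w' i) = s powr q' * (\<Sum>i\<in>I. avg (2 ^ Suc M) g i powr q' * w' i)"
          using s g by (simp add: powr_mult avg_nonneg sum_distrib_left mult_ac)
        also have "\<dots> \<le> s powr q' * (?D * G)"
          unfolding G_def by (intro mult_left_mono V.sum_avg_powr_le g smg I) simp
        finally show "(\<Sum>i\<in>I. ?x i powr q' * w' i) \<le> ?D * s powr q' * G" by (simp only: mult_ac)
        have "(\<Sum>i\<in>I. ?y i powr q' * w' i) = \<delta> powr q' * (\<Sum>i\<in>I. avg (8 * ?N) m i powr q' * w' i)"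
          using \<delta> m by (simp add: powr_mult avg_nonneg sum_distrib_left mult_ac)
        also have "\<dots> \<le> \<delta> powr q' * (?D * S)"
          unfolding S_def by (intro mult_left_mono V.sum_avg_powr_le m smm I) simp
        finally show "(\<Sum>i\<in>I. ?y i powr q' * w' i) \<le> ?D * \<delta> powr q' * S" by (simp only: mult_ac)
        have "(\<Sum>i\<in>I. ?z i powr q' * w' i) \<le> ?D * suminf (tail M) powr q' * S"
          unfolding S_def by (rule V.sum_avg_series_powr_le[OF m smm tail_nonneg tail_summable I])
        also have "\<dots> \<le> ?D * \<delta> powr q' * S"
          unfolding \<delta>_def using q' D S0
          by (intro mult_right_mono mult_left_mono powr_mono2 suminf_tail_le
              suminf_nonneg tail_nonneg tail_summable) auto
        finally show "(\<Sum>i\<in>I. ?z i powr q' * w' i) \<le> ?D * \<delta> powr q' * S" .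
      qed simp
      also have "\<dots> = a * s powr q' * G + (2 * a * \<delta> powr q') * S"
        by (simp add: a_def algebra_simps)
      also have "\<dots> \<le> a * s powr q' * G + 1 / 2 * S"
        using M S0 by (intro add_left_mono mult_right_mono) (auto simp: \<delta>_def)
      finally show ?thesis .
    qed
    \<comment> \<open>Absorption: S is finite, so half of it moves to the left-hand side.\<close>
    then have "S \<le> a * s powr q' * G + 1 / 2 * S"
      unfolding S_def by (intro infsum_le_finite_sums smm) auto
    then have SG: "S \<le> 2 * a * s powr q' * G" by simp
    \<comment> \<open>Return from local means to c itself; \<open>b\<close> depends on N, but N is
      fixed by now.\<close>
    have "F \<le> b * S"
      unfolding F_def
    proof (intro infsum_le_finite_sums smf)
      fix I :: "(int ^ 'd) set" assume I: "finite I"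
      have "(\<Sum>i\<in>I. f i powr q' * w' i) \<le> (\<Sum>i\<in>I. b * (m i powr q' * w' i))"
      proof (rule sum_mono)
        fix i
        have "f i powr q' \<le> (side ?N ^ CARD('d) * K powr (1 / q) * m i) powr q'"
          using q' unfolding m_def by (intro powr_mono2 le_local_mean f)
        also have "\<dots> = b * m i powr q'" by (simp add: b_def powr_mult m)
        finally have "f i powr q' * w' i \<le> b * m i powr q' * w' i" by (intro mult_right_mono V.w_nonneg)
        then show "f i powr q' * w' i \<le> b * (m i powr q' * w' i)" by (simp only: mult.assoc)
      qed
      also have "\<dots> \<le> b * S"
        unfolding S_def sum_distrib_left[symmetric]
        by (intro mult_left_mono finite_sum_le_infsum_UNIV smm I) (simp_all add: b_def)
      finally show "(\<Sum>i\<in>I. f i powr q' * w' i) \<le> b * S" .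
    qed
    also have "\<dots> \<le> b * (2 * a * s powr q' * G)"
      by (intro mult_left_mono SG) (simp add: b_def)
    finally show ?thesis by (simp add: F_def G_def f_def g_def B1_def mult.assoc)
  qed
  show ?thesis
  proof (rule lq_stableI[OF V.q_ge_1 V.w_nonneg])
    show "0 \<le> B1" "0 \<le> B2" using a D by (simp_all add: B1_def B2_def b_def)
    show "(\<lambda>j. A i j * c j) summable_on UNIV" if "c \<in> weighted_lq q' w'" for c i
      using upper[OF that] by blast
    show "mat_apply A c \<in> weighted_lq q' w'" if "c \<in> weighted_lq q' w'" for c
      using upper[OF that] by (simp add: weighted_lq_def)
    show "(\<Sum>\<^sub>\<infinity>i. cmod (c i) powr q' * w' i) \<le> B1 * (\<Sum>\<^sub>\<infinity>i. cmod (mat_apply A c i) powr q' * w' i)"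
      if "c \<in> weighted_lq q' w'" for c by (rule lower[OF that])
    show "(\<Sum>\<^sub>\<infinity>i. cmod (mat_apply A c i) powr q' * w' i) \<le> B2 * (\<Sum>\<^sub>\<infinity>i. cmod (c i) powr q' * w' i)"
      if "c \<in> weighted_lq q' w'" for c using upper[OF that] by blast
  qed
qed

end

theorem theorem1p2:
  fixes A :: "'d::finite lattice_matrix"
  assumes "A \<in> B_class"
    and "\<exists>q w. 1 \<le> q \<and> discrete_A_weight q w \<and> lq_stable q w A"
  shows "\<forall>q' w'. 1 \<le> q' \<and> discrete_A_weight q' w' \<longrightarrow> lq_stable q' w' A"
proof (intro allI impI)
  fix q' :: real and w' :: "int ^ 'd \<Rightarrow> real"
  assume w': "1 \<le> q' \<and> discrete_A_weight q' w'"
  obtain q w where q: "1 \<le> q" and w: "discrete_A_weight q w" and st: "lq_stable q w A"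
    using assms(2) by blast
  obtain K where K: "aq_weight q w K" using discrete_A_weight_imp_aq_weight[OF q w] by blast
  obtain K' where K': "aq_weight q' w' K'" using discrete_A_weight_imp_aq_weight w' by blast
  obtain e :: "nat \<Rightarrow> real" where e: "\<And>k. 0 \<le> e k" "summable e"
    "\<And>k i j. int (2 ^ k div 2) \<le> maxnorm (i - j) \<Longrightarrow> cmod (A i j) \<le> e k / side (2 ^ k) ^ CARD('d)"
    using B_class_dyadic_majorant[OF assms(1)] by blast
  interpret W: aq_weight q w K by (rule K)
  obtain C where C: "0 < C" "\<And>u. u \<in> weighted_lq q w \<Longrightarrow>
      (\<lambda>i. cmod (mat_apply A u i) powr q * w i) summable_on UNIV \<and>
      (\<Sum>\<^sub>\<infinity>i. cmod (u i) powr q * w i) \<le> C * (\<Sum>\<^sub>\<infinity>i. cmod (mat_apply A u i) powr q * w i)"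
    using lq_stableD[OF st q W.w_nonneg] by blast
  interpret stable_matrix q w K A e C
    by unfold_locales (use e C in auto)
  show "lq_stable q' w' A" by (rule stable_transfer[OF K'])
qed

end
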